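(* Let $f_1,\ldots,f_n\in\mathcal{P}$ be non-constant Puiseux polynomials with real coefficients, and assume that the field $F$ generated over $\mathbb{Q}$ by the coefficients of the $f_i$ has transcendence degree at least $1$ over $\mathbb{Q}$. Let $\bar{r}=(r_1,\ldots,r_l)$ be a transcendence basis of $F$ over $\mathbb{Q}$. Then: (1) There is an open formula $\theta(x_1,\ldots,x_l,y_1,\ldots,y_n)$ in the language of ordered rings such that for every $\bar{y}\in\mathbb{R}^n$, $\mathbb{R}\models\theta(\bar{r},\bar{y})$ if and only if there is a real $t\ge 1$ with $y_i=f_i(t)$ for all $i=1,\ldots,n$. (2) Let $\theta$ be any open formula as in (1). Then the ordered ring $\mathbb{Z}[\bar{f}]=\mathbb{Z}[f_1,\ldots,f_n]$ is diophantine correct if and only if for every open neighborhood $U\subseteq\mathbb{R}^l$ of $\bar{r}$ and every positive integer $M$ there are a point $\bar{s}\in U$ and integers $\bar{m}=(m_1,\ldots,m_n)$ with $\min_i|m_i|>M$ and $\mathbb{R}\models\theta(\bar{s},\bar{m})$.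
   Context: $\mathcal{P}$ is the ring of Puiseux polynomials with real coefficients, i.e. finite sums $\sum_{i=0}^{N} a_i t^{i/D}$ with $D$ a positive integer and $a_i\in\mathbb{R}$; these are regarded both as formal objects and as functions from the positive reals to the reals. $\mathcal{P}$ is ordered as a subring of the field of descending Puiseux series with real coefficients: a nonzero element is positive iff its leading coefficient is positive (equivalently, iff it is positive as a function for all sufficiently large $t$). Subrings such as $\mathbb{Z}[\bar f]$ carry the induced ordering. Formulas are in the language of ordered rings $(+,-,\cdot,\le,0,1)$, open meaning quantifier-free. An ordered ring is diophantine correct if it satisfies every universal sentence of this language true in the ordered ring $\mathbb{Z}$. *)

theory Defs
  imports
    "HOL-Analysis.Analysis"
    "HOL-Computational_Algebra.Polynomial"
    "HOL-Library.Poly_Mapping"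
begin

section \<open>Ordered-ring formulas\<close>

text \<open>Full first-order formulas over an arbitrary type of variables. An open formula
  in the variables \<open>x\<^sub>1, \<dots>, x\<^sub>l, y\<^sub>1, \<dots>, y\<^sub>n\<close> is a quantifier-free formula over the finite variable
  type \<open>'l + 'n\<close>; sentences are formulas over \<open>nat\<close> without free variables.\<close>

datatype 'v trm =
    Var 'v
  | Zero
  | One
  | Add "'v trm" "'v trm"
  | Sub "'v trm" "'v trm"
  | Mul "'v trm" "'v trm"

datatype 'v fm =
    Eq "'v trm" "'v trm"
  | Le "'v trm" "'v trm"
  | Neg "'v fm"
  | And "'v fm" "'v fm"
  | Or "'v fm" "'v fm"
  | Forall 'v "'v fm"
  | Exists 'v "'v fm"

primrec quantifier_free :: "'v fm \<Rightarrow> bool" where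
  "quantifier_free (Eq s t) = True"
| "quantifier_free (Le s t) = True"
| "quantifier_free (Neg \<phi>) = quantifier_free \<phi>"
| "quantifier_free (And \<phi> \<psi>) = (quantifier_free \<phi> \<and> quantifier_free \<psi>)"
| "quantifier_free (Or \<phi> \<psi>) = (quantifier_free \<phi> \<and> quantifier_free \<psi>)"
| "quantifier_free (Forall x \<phi>) = False"
| "quantifier_free (Exists x \<phi>) = False"

primrec free_vars :: "'v fm \<Rightarrow> 'v set" where
  "free_vars (Eq s t) = set_trm s \<union> set_trm t"
| "free_vars (Le s t) = set_trm s \<union> set_trm t"
| "free_vars (Neg \<phi>) = free_vars \<phi>"
| "free_vars (And \<phi> \<psi>) = free_vars \<phi> \<union> free_vars \<psi>"
| "free_vars (Or \<phi> \<psi>) = free_vars \<phi> \<union> free_vars \<psi>"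
| "free_vars (Forall x \<phi>) = free_vars \<phi> - {x}"
| "free_vars (Exists x \<phi>) = free_vars \<phi> - {x}"

inductive universal :: "'v fm \<Rightarrow> bool" where
  "quantifier_free \<phi> \<Longrightarrow> universal \<phi>"
| "universal \<phi> \<Longrightarrow> universal (Forall x \<phi>)"

definition universal_sentence :: "nat fm \<Rightarrow> bool" where
  "universal_sentence \<phi> \<longleftrightarrow> universal \<phi> \<and> free_vars \<phi> = {}"

text \<open>A structure is a subring \<open>A\<close> of a commutative ring type, which supplies the ring operations,
  together with an order relation \<open>le\<close>.\<close>

primrec trm_value :: "('v \<Rightarrow> 'a::comm_ring_1) \<Rightarrow> 'v trm \<Rightarrow> 'a" where
  "trm_value v (Var x) = v x"
| "trm_value v Zero = 0"
| "trm_value v One = 1"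
| "trm_value v (Add s t) = trm_value v s + trm_value v t"
| "trm_value v (Sub s t) = trm_value v s - trm_value v t"
| "trm_value v (Mul s t) = trm_value v s * trm_value v t"

primrec sat :: "'a::comm_ring_1 set \<Rightarrow> ('a \<Rightarrow> 'a \<Rightarrow> bool) \<Rightarrow> 'v fm \<Rightarrow> ('v \<Rightarrow> 'a) \<Rightarrow> bool" where
  "sat A le (Eq s t) v \<longleftrightarrow> trm_value v s = trm_value v t"
| "sat A le (Le s t) v \<longleftrightarrow> le (trm_value v s) (trm_value v t)"
| "sat A le (Neg \<phi>) v \<longleftrightarrow> \<not> sat A le \<phi> v"
| "sat A le (And \<phi> \<psi>) v \<longleftrightarrow> sat A le \<phi> v \<and> sat A le \<psi> v"
| "sat A le (Or \<phi> \<psi>) v \<longleftrightarrow> sat A le \<phi> v \<or> sat A le \<psi> v"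
| "sat A le (Forall x \<phi>) v \<longleftrightarrow> (\<forall>a\<in>A. sat A le \<phi> (v(x := a)))"
| "sat A le (Exists x \<phi>) v \<longleftrightarrow> (\<exists>a\<in>A. sat A le \<phi> (v(x := a)))"

definition true_in :: "'a::comm_ring_1 set \<Rightarrow> ('a \<Rightarrow> 'a \<Rightarrow> bool) \<Rightarrow> 'v fm \<Rightarrow> bool" where
  "true_in A le \<phi> \<longleftrightarrow> (\<forall>v. range v \<subseteq> A \<longrightarrow> sat A le \<phi> v)"

definition diophantine_correct :: "'a::comm_ring_1 set \<Rightarrow> ('a \<Rightarrow> 'a \<Rightarrow> bool) \<Rightarrow> bool" where
  "diophantine_correct A le \<longleftrightarrow>
     (\<forall>\<phi>. universal_sentence \<phi> \<longrightarrow> true_in UNIV ((\<le>) :: int \<Rightarrow> int \<Rightarrow> bool) \<phi> \<longrightarrow> true_in A le \<phi>)"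

definition real_models :: "('l::finite + 'n::finite) fm \<Rightarrow> real^'l \<Rightarrow> real^'n \<Rightarrow> bool" where
  "real_models \<theta> x y \<longleftrightarrow> sat UNIV (\<le>) \<theta> (case_sum (\<lambda>j. x $ j) (\<lambda>i. y $ i))"


section \<open>Subrings, subfields, transcendence bases\<close>

definition subring :: "'a::comm_ring_1 set \<Rightarrow> bool" where
  "subring A \<longleftrightarrow> 0 \<in> A \<and> 1 \<in> A \<and> (\<forall>a\<in>A. \<forall>b\<in>A. a + b \<in> A \<and> a - b \<in> A \<and> a * b \<in> A)"

definition subfield :: "'a::field set \<Rightarrow> bool" where
  "subfield K \<longleftrightarrow> subring K \<and> (\<forall>a\<in>K. inverse a \<in> K)"

definition algebraic_over :: "'a::field set \<Rightarrow> 'a \<Rightarrow> bool" where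
  "algebraic_over K a \<longleftrightarrow> (\<exists>p. p \<noteq> 0 \<and> (\<forall>k. coeff p k \<in> K) \<and> poly p a = 0)"

text \<open>A polynomial in variables indexed by \<open>'l\<close> maps monomials, i.e. exponent vectors
  \<open>'l \<Rightarrow>\<^sub>0 nat\<close>, to coefficients.\<close>

definition mpoly_value :: "(('l::finite \<Rightarrow>\<^sub>0 nat) \<Rightarrow>\<^sub>0 rat) \<Rightarrow> ('l \<Rightarrow> real) \<Rightarrow> real" where
  "mpoly_value p r =
     (\<Sum>m\<in>Poly_Mapping.keys p. of_rat (Poly_Mapping.lookup p m) * (\<Prod>j\<in>UNIV. r j ^ Poly_Mapping.lookup m j))"

definition algebraically_independent :: "('l::finite \<Rightarrow> real) \<Rightarrow> bool" where
  "algebraically_independent r \<longleftrightarrow> (\<forall>p. mpoly_value p r = 0 \<longrightarrow> p = 0)"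

text \<open>Subfields of the reals contain the rationals, so the hull below is the field generated over
  the rationals. Since the type \<open>'l\<close> is nonempty, a field with such a basis has
  transcendence degree \<open>CARD('l) \<ge> 1\<close>.\<close>

definition transcendence_basis :: "real^'l \<Rightarrow> real set \<Rightarrow> bool" where
  "transcendence_basis r F \<longleftrightarrow>
     (\<forall>j. r $ j \<in> F) \<and>
     algebraically_independent (\<lambda>j. r $ j) \<and>
     (\<forall>a\<in>F. algebraic_over (subfield hull (range (\<lambda>j. r $ j))) a)"


section \<open>Puiseux polynomials\<close>

text \<open>An element of \<open>rat \<Rightarrow>\<^sub>0 real\<close> maps rational exponents to coefficients; the ring structure of
  \<^theory>\<open>HOL-Library.Poly_Mapping\<close> is the convolution product. The finitely many exponents occurring have
  a common denominator \<open>D\<close>, so Puiseux polynomials are the elements with nonnegative exponents.\<close>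

type_synonym gen_puiseux = "rat \<Rightarrow>\<^sub>0 real"

definition puiseux_polynomials :: "gen_puiseux set" where
  "puiseux_polynomials = {p. \<forall>q\<in>Poly_Mapping.keys p. 0 \<le> q}"

definition puiseux_const :: "gen_puiseux \<Rightarrow> bool" where
  "puiseux_const p \<longleftrightarrow> (\<exists>c. p = Poly_Mapping.single 0 c)"

text \<open>Meaningful for \<open>t > 0\<close> only.\<close>

definition puiseux_value :: "gen_puiseux \<Rightarrow> real \<Rightarrow> real" where
  "puiseux_value p t = (\<Sum>q\<in>Poly_Mapping.keys p. Poly_Mapping.lookup p q * t powr of_rat q)"

definition puiseux_coeffs :: "gen_puiseux \<Rightarrow> real set" where
  "puiseux_coeffs p = Poly_Mapping.lookup p ` Poly_Mapping.keys p"

definition puiseux_lead_coeff :: "gen_puiseux \<Rightarrow> real" where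
  "puiseux_lead_coeff p = Poly_Mapping.lookup p (Max (Poly_Mapping.keys p))"

text \<open>This is not the lexicographic order that the library puts on \<open>rat \<Rightarrow>\<^sub>0 real\<close>, which
  looks at the smallest exponent first.\<close>

definition puiseux_le :: "gen_puiseux \<Rightarrow> gen_puiseux \<Rightarrow> bool" where
  "puiseux_le p q \<longleftrightarrow> p = q \<or> puiseux_lead_coeff (q - p) > 0"

definition defines_curve :: "('l::finite + 'n::finite) fm \<Rightarrow> real^'l \<Rightarrow> ('n \<Rightarrow> gen_puiseux) \<Rightarrow> bool" where
  "defines_curve \<theta> r f \<longleftrightarrow> quantifier_free \<theta> \<and>
     (\<forall>y. real_models \<theta> r y \<longleftrightarrow> (\<exists>t\<ge>1. \<forall>i. y $ i = puiseux_value (f i) t))"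

end

theory Submission
  imports Defs
begin

text \<open>Both parts rest on quantifier elimination over the reals, obtained as in the Cohen-Hoermander
  algorithm. Two tuples of univariate real polynomials have the same sign diagram iff some increasing
  bijection of the line carries the signs of one to those of the other. For a family with
  polynomial parameters, such a bijection for the lower-degree members, the derivative and the
  pseudo-remainders of a polynomial \<open>p\<close> of maximal degree can be corrected so as to match \<open>p\<close> as
  well; hence the sign diagram depends only on the signs of finitely many polynomials in the parameters.

  (1) Each coefficient of the \<open>f\<^sub>i\<close> is algebraic over \<open>\<rat>(r)\<close>, hence singled out by a polynomial
  equation over \<open>\<int>[r]\<close> and a rational interval; substituting \<open>t = \<tau>\<^sup>D\<close> makes the curve a projection of a
  semialgebraic set.

  (2) A quantifier-free formula holds at \<open>f\<close> in \<open>\<int>[f]\<close> iff it holds at \<open>f(t)\<close> for all large \<open>t\<close>. If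
  \<open>\<int>[f]\<close> is diophantine correct, apply this to the formula in \<open>y\<close> stating that \<open>\<theta>(s, y)\<close> has a solution \<open>s\<close>
  in a rational box around \<open>r\<close> and that all \<open>\<bar>y\<^sub>i\<bar> > M\<close>. Conversely, suppose that \<open>\<psi>\<close> holds at \<open>f\<close>. Then \<open>\<psi>(y)\<close>
  follows from \<open>\<theta>(r, y)\<close> and \<open>\<bar>y\<^sub>i\<bar> > M\<close> for some \<open>M\<close>. This is a quantifier-free condition on \<open>r\<close>, which
  persists in a neighbourhood because \<open>r\<close> is algebraically independent; so \<open>\<psi>\<close> has an integer solution.\<close>


section \<open>Matching the signs of real polynomials\<close>

text \<open>Piecewise linear on the interval from \<open>a\<close> to \<open>b\<close>, with one
  breakpoint at \<open>e\<close>. Exchanging \<open>e\<close> and \<open>d\<close> in the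
  construction \<open>K\<close> gives the inverse, whence surjectivity.\<close>

lemma strict_mono_surj_move_point:
  fixes a b d e :: real
  assumes "a < e" "e < b" "a < d" "d < b"
  obtains k where "strict_mono k" "surj k" "k e = d" "\<And>x. x \<le> a \<or> b \<le> x \<Longrightarrow> k x = x"
proof -
  define K where "K e d x = (if x \<le> a \<or> b \<le> x then x
     else if x \<le> e then a + (x - a) * ((d - a) / (e - a)) else b - (b - x) * ((b - d) / (b - e)))" for e d x :: real
  have lower: "K e d x = a + (x - a) * ((d - a) / (e - a))" if "a < x" "x \<le> e" "e < b" for e d x
    using that by (simp add: K_def)
  have upper: "K e d x = b - (b - x) * ((b - d) / (b - e))" if "e < x" "x < b" "a < e" for e d x
    using that by (simp add: K_def)
  have low: "a < K e d x \<and> K e d x \<le> d" if "a < x" "x \<le> e" "a < e" "e < b" "a < d" "d < b" for e d x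
  proof -
    have "0 < (x - a) * ((d - a) / (e - a))" using that by simp
    moreover have "(x - a) * ((d - a) / (e - a)) \<le> (e - a) * ((d - a) / (e - a))"
      using that by (intro mult_right_mono) auto
    ultimately show ?thesis using that by (auto simp: lower)
  qed
  have high: "d < K e d x \<and> K e d x < b" if "e < x" "x < b" "a < e" "e < b" "a < d" "d < b" for e d x
  proof -
    have "0 < (b - x) * ((b - d) / (b - e))" using that by simp
    moreover have "(b - x) * ((b - d) / (b - e)) < (b - e) * ((b - d) / (b - e))"
      using that by (intro mult_strict_right_mono) auto
    ultimately show ?thesis using that by (auto simp: upper)
  qed
  have out: "K e d x = x" if "x \<le> a \<or> b \<le> x" for e d x
    using that by (auto simp: K_def)
  have inv: "K e d (K d e x) = x" if "a < e" "e < b" "a < d" "d < b" for e d x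
  proof -
    consider "x \<le> a \<or> b \<le> x" | "a < x" "x \<le> d" | "d < x" "x < b" by linarith
    then show ?thesis
    proof cases
      case 1
      then show ?thesis by (simp add: out)
    next
      case 2
      then have "a < K d e x" "K d e x \<le> e" using low[of x d e] that by auto
      then show ?thesis using lower[of "K d e x" e d] lower[of x d e] 2 that by simp
    next
      case 3
      then have "e < K d e x" "K d e x < b" using high[of d x e] that by auto
      then show ?thesis using upper[of e "K d e x" d] upper[of d x e] 3 that by simp
    qed
  qed
  have "K e d x < K e d y" if "x < y" for x y
  proof -
    consider "x \<le> a \<or> b \<le> x \<or> y \<le> a \<or> b \<le> y" | "a < x" "y < b" "y \<le> e" | "a < x" "y < b" "x \<le> e" "e < y"
      | "a < x" "y < b" "e < x" by linarith
    then show ?thesis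
    proof cases
      case 1
      have range: "a < K e d z \<and> K e d z < b" if "a < z" "z < b" for z
        using low[of z e d] high[of e z d] that assms by (cases "z \<le> e") auto
      show ?thesis
        using 1 that out[of x e d] out[of y e d] range[of x] range[of y] assms
        by (cases "x \<le> a"; cases "b \<le> x"; cases "y \<le> a"; cases "b \<le> y") auto
    next
      case 2
      have "(x - a) * ((d - a) / (e - a)) < (y - a) * ((d - a) / (e - a))"
        using assms that 2 by (intro mult_strict_right_mono) auto
      then show ?thesis using 2 that assms lower[of x e d] lower[of y e d] by simp
    next
      case 3
      then have "K e d x \<le> d" "d < K e d y" using low[of x e d] high[of e y d] assms by auto
      then show ?thesis by linarith
    next
      case 4
      have "(b - y) * ((b - d) / (b - e)) < (b - x) * ((b - d) / (b - e))"
        using assms that 4 by (intro mult_strict_right_mono) auto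
      then show ?thesis using 4 that assms upper[of e x d] upper[of e y d] by simp
    qed
  qed
  then have "strict_mono (K e d)" by (simp add: strict_mono_def)
  moreover have "surj (K e d)" using inv[OF assms] by (metis surjI)
  moreover have "K e d e = d" using assms by (simp add: K_def)
  ultimately show thesis using that[of "K e d"] out by blast
qed

text \<open>Room on both sides of the interval is needed twice: for the support of a map that moves
  a point inside it, and for rational end points that isolate a root.\<close>

lemma finite_avoid_interval:
  fixes N :: "real set"
  assumes "finite N" "\<And>z. z \<in> N \<Longrightarrow> z < lo \<or> hi < z"
  shows "\<exists>a b. a < lo \<and> hi < b \<and> (\<forall>z\<in>N. z < a \<or> b < z)"
  using assms
proof (induction N)
  case empty
  show ?case by (intro exI[of _ "lo - 1"] exI[of _ "hi + 1"]) auto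
next
  case (insert y N)
  then obtain a b where ab: "a < lo" "hi < b" "\<forall>z\<in>N. z < a \<or> b < z" by auto
  show ?case
  proof (cases "y < lo")
    case True
    obtain a' where "max a y < a'" "a' < lo" using dense[of "max a y" lo] ab True by auto
    then show ?thesis using ab by (intro exI[of _ a'] exI[of _ b]) auto
  next
    case False
    then have "hi < y" using insert.prems by auto
    then obtain b' where "hi < b'" "b' < min b y" using dense[of hi "min b y"] ab by auto
    then show ?thesis using ab by (intro exI[of _ a] exI[of _ b']) auto
  qed
qed

section \<open>Sign changes and growth of real polynomials\<close>

lemma poly_sgn_eq_no_root:
  fixes p :: "real poly"
  assumes "\<And>z. x \<le> z \<Longrightarrow> z \<le> y \<Longrightarrow> poly p z \<noteq> 0" "x \<le> y"
  shows "sgn (poly p x) = sgn (poly p y)"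
proof (rule ccontr)
  assume *: "sgn (poly p x) \<noteq> sgn (poly p y)"
  then have "x < y" using assms(2) by (cases "x = y") auto
  moreover have "poly p x * poly p y < 0"
    using * assms(1)[of x] assms(1)[of y] assms(2) by (auto simp: sgn_real_def mult_less_0_iff split: if_splits)
  ultimately show False using poly_IVT[of x y p] assms(1) by force
qed

lemma poly_strict_increasing:
  fixes p :: "real poly"
  assumes "x < y" "\<And>z. x < z \<Longrightarrow> z < y \<Longrightarrow> 0 < poly (pderiv p) z"
  shows "poly p x < poly p y"
proof -
  obtain z where "x < z" "z < y" "poly p y - poly p x = (y - x) * poly (pderiv p) z"
    using poly_MVT[OF assms(1), of p] by auto
  then show ?thesis using assms(2)[of z] assms(1) by (metis diff_gt_0_iff_gt mult_pos_pos)
qed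

text \<open>With a negative leading coefficient, the derivative would have one too and would be
  negative far out. This replaces the right end point in intermediate value arguments when no
  critical point lies further right.\<close>

lemma poly_eventually_positive:
  fixes p :: "real poly"
  assumes "degree p > 0" "\<And>x. c \<le> x \<Longrightarrow> 0 < poly (pderiv p) x"
  shows "\<exists>y>c. 0 < poly p y"
proof -
  have "lead_coeff p > 0"
  proof (rule ccontr)
    assume "\<not> lead_coeff p > 0"
    then have "lead_coeff p < 0" using assms(1) by (metis degree_0 leading_coeff_0_iff less_irrefl linorder_cases)
    then have "lead_coeff (- pderiv p) > 0"
      using assms(1) by (simp add: degree_pderiv coeff_pderiv mult_pos_neg)
    then obtain n where "\<forall>x\<ge>n. poly (- pderiv p) x \<ge> lead_coeff (- pderiv p)"
      using poly_pinfty_gt_lc by blast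
    then have "poly (- pderiv p) (max n c) > 0" using \<open>lead_coeff (- pderiv p) > 0\<close>
      by (meson less_le_trans max.cobounded1)
    then show False using assms(2)[of "max n c"] by simp
  qed
  then obtain n where "\<forall>x\<ge>n. poly p x \<ge> lead_coeff p" using poly_pinfty_gt_lc by blast
  then have "poly p (max n (c + 1)) > 0" using \<open>lead_coeff p > 0\<close>
    by (meson less_le_trans max.cobounded1)
  then show ?thesis by (intro exI[of _ "max n (c + 1)"]) auto
qed

section \<open>Roots of one polynomial matched with roots of another\<close>

text \<open>The intended \<open>Z\<close> consists of the roots of the polynomials matched already,
  the derivative of \<open>p\<close> among them. Between neighbouring points of \<open>Z\<close> the
  polynomial \<open>p\<close> is strictly monotone, and so is \<open>q\<close> between their images;
  only the positions of simple roots remain to be corrected.\<close>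

locale sign_matching =
  fixes p q :: "real poly" and h :: "real \<Rightarrow> real" and Z :: "real set"
  assumes finite_Z: "finite Z"
    and strict_mono_h: "strict_mono h"
    and surj_h: "surj h"
    and degree_p: "degree p > 0"
    and degree_q: "degree q > 0"
    and critical_points: "poly (pderiv p) x = 0 \<Longrightarrow> x \<in> Z"
    and sgn_pderiv: "sgn (poly (pderiv p) x) = sgn (poly (pderiv q) (h x))"
    and sgn_Z: "z \<in> Z \<Longrightarrow> sgn (poly p z) = sgn (poly q (h z))"

text \<open>Together with the reflection of the line, this symmetry reduces the four sign patterns
  of derivative and value at a point to a single one.\<close>

lemma sign_matching_uminus:
  assumes "sign_matching p q h Z"
  shows "sign_matching (- p) (- q) h Z"
proof -
  interpret sign_matching p q h Z by fact
  show ?thesis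
    by unfold_locales
      (simp_all add: finite_Z strict_mono_h surj_h degree_p degree_q pderiv_minus critical_points
        sgn_pderiv sgn_Z sgn_minus)
qed

text \<open>\<open>h\<close> is conjugated by negation, so that it stays increasing.\<close>

lemma sign_matching_reflect:
  assumes "sign_matching p q h Z"
  shows "sign_matching (p \<circ>\<^sub>p [:0, - 1:]) (q \<circ>\<^sub>p [:0, - 1:]) (\<lambda>x. - h (- x)) (uminus ` Z)"
proof -
  interpret sign_matching p q h Z by fact
  show ?thesis
  proof
    show "strict_mono (\<lambda>x. - h (- x))"
      by (intro strict_monoI) (simp add: strict_mono_less[OF strict_mono_h])
    show "surj (\<lambda>x. - h (- x))"
      unfolding surj_def
    proof
      fix y
      obtain x where "- y = h x" using surj_h by (metis surjD)
      then show "\<exists>x. y = - h (- x)" by (intro exI[of _ "- x"]) simp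
    qed
  next
    fix x
    assume "poly (pderiv (p \<circ>\<^sub>p [:0, - 1:])) x = 0"
    then have "- x \<in> Z"
      by (intro critical_points) (simp add: pderiv_pcompose poly_pcompose pderiv_pCons)
    then show "x \<in> uminus ` Z" by force
  qed (auto simp: finite_Z degree_p degree_q degree_pcompose pderiv_pcompose poly_pcompose
      pderiv_pCons sgn_pderiv sgn_Z sgn_minus)
qed

context sign_matching
begin

lemma h_less_iff: "h x < h y \<longleftrightarrow> x < y"
  using strict_mono_h by (simp add: strict_mono_less)

lemma h_le_iff: "h x \<le> h y \<longleftrightarrow> x \<le> y"
  using strict_mono_h by (simp add: strict_mono_less_eq)

lemma pderiv_pos_iff: "0 < poly (pderiv q) (h x) \<longleftrightarrow> 0 < poly (pderiv p) x"
  using sgn_pderiv[of x] by (metis sgn_greater)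

lemma increasing_up_to_Z:
  assumes "0 < poly (pderiv p) x" "x \<le> y" "\<And>z. z \<in> Z \<Longrightarrow> x < z \<Longrightarrow> y < z"
  shows "0 < poly (pderiv p) y"
proof -
  have "poly (pderiv p) z \<noteq> 0" if "x \<le> z" "z \<le> y" for z
    using critical_points[of z] assms that by (cases "z = x") force+
  then have "sgn (poly (pderiv p) x) = sgn (poly (pderiv p) y)"
    using poly_sgn_eq_no_root assms(2) by blast
  then show ?thesis using assms(1) by (metis sgn_greater)
qed

lemma image_increasing:
  assumes "x < y" "\<And>z. x < z \<Longrightarrow> z < y \<Longrightarrow> 0 < poly (pderiv p) z"
  shows "poly q (h x) < poly q (h y)"
proof (rule poly_strict_increasing)
  show "h x < h y" using assms(1) by (simp add: h_less_iff)
  fix w assume w: "h x < w" "w < h y"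
  obtain z where "w = h z" using surj_h by (metis surjD)
  then show "0 < poly (pderiv q) w" using w assms(2)[of z] by (simp add: h_less_iff pderiv_pos_iff)
qed

lemma next_Z:
  obtains (last) "\<And>z. z \<in> Z \<Longrightarrow> z \<le> x"
  | (between) b where "b \<in> Z" "x < b" "\<And>z. z \<in> Z \<Longrightarrow> x < z \<Longrightarrow> b \<le> z"
proof (cases "{z \<in> Z. x < z} = {}")
  case True
  then show ?thesis using last by force
next
  case False
  have "finite {z \<in> Z. x < z}" using finite_Z by simp
  from Min_in[OF this False] Min_le[OF this] show ?thesis
    by (intro between[of "Min {z \<in> Z. x < z}"]) auto
qed

text \<open>From \<open>c\<close> to the next point \<open>b\<close> of \<open>Z\<close> the
  polynomial \<open>p\<close> increases, so it is positive at \<open>b\<close>; hence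
  \<open>q\<close> is positive at \<open>h b\<close>, and the intermediate value theorem gives a
  root before \<open>h b\<close>. If there is no such \<open>b\<close>, the derivative of
  \<open>q\<close> stays positive beyond \<open>h c\<close>, and growth at infinity takes its
  place.\<close>

lemma matching_root_right:
  assumes c: "c \<notin> Z" "poly p c = 0" "0 < poly (pderiv p) c" "poly q (h c) < 0"
  shows "\<exists>d>h c. poly q d = 0 \<and> (\<forall>z\<in>Z. \<not> (h c \<le> h z \<and> h z \<le> d))"
proof (cases rule: next_Z[of c])
  case last
  have pos: "0 < poly (pderiv p) y" if "c \<le> y" for y
    using increasing_up_to_Z[OF c(3) that] last by force
  have "0 < poly (pderiv q) w" if "h c \<le> w" for w
    using that surj_h pos by (metis h_le_iff pderiv_pos_iff surjD)
  then obtain y where y: "y > h c" "0 < poly q y"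
    using poly_eventually_positive[OF degree_q] by blast
  then obtain d where d: "h c < d" "d < y" "poly q d = 0" using poly_IVT_pos[of "h c" y q] c(4) by auto
  have "\<not> (h c \<le> h z)" if "z \<in> Z" for z
    using last[OF that] that c(1) by (cases "z = c") (auto simp: h_le_iff)
  then show ?thesis using d by blast
next
  case (between b)
  have pos: "0 < poly (pderiv p) y" if "c \<le> y" "y < b" for y
    using increasing_up_to_Z[OF c(3) that(1)] between(3) that by force
  have "poly p c < poly p b" using poly_strict_increasing[of c b p] pos between by auto
  then have "0 < poly q (h b)" using c(2) sgn_Z[OF between(1)] by (metis sgn_greater)
  then obtain d where d: "h c < d" "d < h b" "poly q d = 0"
    using poly_IVT_pos[of "h c" "h b" q] c(4) between by (auto simp: h_less_iff)
  have "\<not> (h c \<le> h z \<and> h z \<le> d)" if "z \<in> Z" for z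
  proof
    assume "h c \<le> h z \<and> h z \<le> d"
    then have "c \<le> z" "h z < h b" using d by (auto simp: h_le_iff)
    moreover have "z \<noteq> c" using that c by auto
    ultimately show False using between(3)[OF that] by (simp add: h_less_iff)
  qed
  then show ?thesis using d by blast
qed

text \<open>Up to the next point of \<open>Z\<close> the values of \<open>q\<close> along
  \<open>h\<close> increase. They reach a value at most 0 there: at the image of a root of
  \<open>p\<close>, or, if \<open>p\<close> has not become positive by then, at the image of that
  point of \<open>Z\<close>. If no point of \<open>Z\<close> follows, \<open>p\<close> must have a
  root further right.\<close>

lemma negative_image:
  assumes x: "poly p x < 0" "0 < poly (pderiv p) x"
    and roots: "\<And>c. poly p c = 0 \<Longrightarrow> poly q (h c) = 0"
  shows "poly q (h x) < 0"
proof (cases rule: next_Z[of x])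
  case last
  have pos: "0 < poly (pderiv p) y" if "x \<le> y" for y
    using increasing_up_to_Z[OF x(2) that] last by force
  then obtain y where y: "x < y" "0 < poly p y" using poly_eventually_positive[OF degree_p] by blast
  then obtain c where c: "x < c" "poly p c = 0" using poly_IVT_pos[of x y p] x by auto
  then show ?thesis using image_increasing[of x c] pos roots[of c] by auto
next
  case (between b)
  have pos: "0 < poly (pderiv p) y" if "x \<le> y" "y < b" for y
    using increasing_up_to_Z[OF x(2) that(1)] between(3) that by force
  show ?thesis
  proof (cases "poly p b > 0")
    case True
    then obtain c where c: "x < c" "c < b" "poly p c = 0" using poly_IVT_pos[of x b p] x between by auto
    then show ?thesis using image_increasing[of x c] pos roots[of c] by auto
  next
    case False
    then have "poly q (h b) \<le> 0" using sgn_Z[OF between(1)] by (metis sgn_greater not_less)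
    then show ?thesis using image_increasing[of x b] pos between by auto
  qed
qed

end

text \<open>The signs of the derivative of \<open>p\<close> at \<open>c\<close> and of
  \<open>q\<close> at \<open>h c\<close> tell on which side of \<open>h c\<close> to look for the
  root. Negation, reflection or both turn every combination into a positive derivative with a
  negative value.\<close>

lemma (in sign_matching) matching_root:
  assumes c: "c \<notin> Z" "poly p c = 0"
  shows "\<exists>d. poly q d = 0 \<and> (\<forall>z\<in>Z. h z < min (h c) d \<or> max (h c) d < h z)"
proof -
  have ne: "poly (pderiv p) c \<noteq> 0" using critical_points c by blast
  have refl: "sign_matching (p \<circ>\<^sub>p [:0, - 1:]) (q \<circ>\<^sub>p [:0, - 1:]) (\<lambda>x. - h (- x)) (uminus ` Z)"
    using sign_matching_reflect sign_matching_axioms by blast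
  have cZ: "- c \<notin> uminus ` Z" using c by auto
  have hc: "h z \<noteq> h c" if "z \<in> Z" for z using that c strict_mono_eq[OF strict_mono_h] by metis
  consider "poly q (h c) = 0" | "0 < poly (pderiv p) c" "poly q (h c) < 0"
    | "poly (pderiv p) c < 0" "0 < poly q (h c)" | "0 < poly (pderiv p) c" "0 < poly q (h c)"
    | "poly (pderiv p) c < 0" "poly q (h c) < 0" using ne by linarith
  then show ?thesis
  proof cases
    case 1
    then show ?thesis using hc by (intro exI[of _ "h c"]) force
  next
    case 2
    obtain d where "d > h c" "poly q d = 0" "\<forall>z\<in>Z. \<not> (h c \<le> h z \<and> h z \<le> d)"
      using matching_root_right[OF c(1,2) 2] by blast
    then show ?thesis by (intro exI[of _ d]) force
  next
    case 3
    obtain d where "d > h c" "poly q d = 0" "\<forall>z\<in>Z. \<not> (h c \<le> h z \<and> h z \<le> d)"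
      using sign_matching.matching_root_right[OF sign_matching_uminus[OF sign_matching_axioms] c(1)] c(2) 3
      by (auto simp: pderiv_minus)
    then show ?thesis by (intro exI[of _ d]) force
  next
    case 4
    obtain d where "d > - h c" "poly q (- d) = 0" "\<forall>z\<in>Z. \<not> (- h c \<le> - h z \<and> - h z \<le> d)"
      using sign_matching.matching_root_right[OF sign_matching_uminus[OF refl] cZ] c(2) 4
      by (auto simp: pderiv_minus pderiv_pcompose poly_pcompose pderiv_pCons)
    then show ?thesis by (intro exI[of _ "- d"]) force
  next
    case 5
    obtain d where "d > - h c" "poly q (- d) = 0" "\<forall>z\<in>Z. \<not> (- h c \<le> - h z \<and> - h z \<le> d)"
      using sign_matching.matching_root_right[OF refl cZ] c(2) 5
      by (auto simp: pderiv_pcompose poly_pcompose pderiv_pCons)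
    then show ?thesis by (intro exI[of _ "- d"]) force
  qed
qed

text \<open>Off \<open>Z\<close> and off the roots of \<open>p\<close>, the same two symmetries
  reduce the claim to a negative value with positive derivative.\<close>

lemma (in sign_matching) sgn_image:
  assumes roots: "\<And>c. poly p c = 0 \<Longrightarrow> poly q (h c) = 0"
  shows "sgn (poly p x) = sgn (poly q (h x))"
proof (cases "x \<in> Z \<or> poly p x = 0")
  case True
  then show ?thesis using sgn_Z roots by auto
next
  case False
  then have ne: "poly (pderiv p) x \<noteq> 0" using critical_points by blast
  have refl: "sign_matching (p \<circ>\<^sub>p [:0, - 1:]) (q \<circ>\<^sub>p [:0, - 1:]) (\<lambda>x. - h (- x)) (uminus ` Z)"
    using sign_matching_reflect sign_matching_axioms by blast
  consider "0 < poly (pderiv p) x" "poly p x < 0"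
    | "poly (pderiv p) x < 0" "0 < poly p x" | "0 < poly (pderiv p) x" "0 < poly p x"
    | "poly (pderiv p) x < 0" "poly p x < 0" using ne False by linarith
  then show ?thesis
  proof cases
    case 1
    then show ?thesis using negative_image[of x] roots by auto
  next
    case 2
    then have "poly (- q) (h x) < 0"
      by (intro sign_matching.negative_image[OF sign_matching_uminus[OF sign_matching_axioms]])
        (auto simp: pderiv_minus roots)
    then show ?thesis using 2 by simp
  next
    case 3
    then have "poly (- (q \<circ>\<^sub>p [:0, - 1:])) (- h (- (- x))) < 0"
      by (intro sign_matching.negative_image[OF sign_matching_uminus[OF refl]])
        (auto simp: pderiv_minus pderiv_pcompose poly_pcompose pderiv_pCons roots)
    then show ?thesis using 3 by (simp add: poly_pcompose)
  next
    case 4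
    then have "poly (q \<circ>\<^sub>p [:0, - 1:]) (- h (- (- x))) < 0"
      by (intro sign_matching.negative_image[OF refl])
        (auto simp: pderiv_pcompose poly_pcompose pderiv_pCons roots)
    then show ?thesis using 4 by (simp add: poly_pcompose)
  qed
qed

text \<open>The roots of \<open>p\<close> outside \<open>Z\<close> are treated one at a time: \<open>h\<close> is followed by a map that moves the
  image of the root onto the matching root of \<open>q\<close> and is the identity outside an interval that
  contains no point of \<open>h ` Z\<close>.\<close>

lemma extend_sign_matching:
  fixes p q :: "real poly" and u w :: "'i \<Rightarrow> real poly"
  assumes I: "finite I" and h: "strict_mono h" "surj h"
    and match: "\<And>i x. i \<in> I \<Longrightarrow> sgn (poly (u i) x) = sgn (poly (w i) (h x))"
    and deriv: "i0 \<in> I" "u i0 = pderiv p" "w i0 = pderiv q"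
    and deg: "degree p > 0" "degree q > 0"
    and at_roots: "\<And>i z. i \<in> I \<Longrightarrow> u i \<noteq> 0 \<Longrightarrow> poly (u i) z = 0 \<Longrightarrow> sgn (poly p z) = sgn (poly q (h z))"
  shows "\<exists>h'. strict_mono h' \<and> surj h' \<and>
    (\<forall>i\<in>I. \<forall>x. sgn (poly (u i) x) = sgn (poly (w i) (h' x))) \<and>
    (\<forall>x. sgn (poly p x) = sgn (poly q (h' x)))"
proof -
  \<comment> \<open>Vanishing members are left out to keep \<open>Z\<close> finite. The derivative
    of \<open>p\<close> is not among them, because \<open>p\<close> has positive degree.\<close>
  define Z where "Z = (\<Union>i\<in>{i \<in> I. u i \<noteq> 0}. {z. poly (u i) z = 0})"
  have finZ: "finite Z" using I by (auto simp: Z_def poly_roots_finite)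
  have "pderiv p \<noteq> 0" using deg by (simp add: pderiv_eq_0_iff)
  then have crit: "z \<in> Z" if "poly (pderiv p) z = 0" for z
    using deriv that by (auto simp: Z_def)
  have sm: "sign_matching p q g Z" if g: "strict_mono g" "surj g"
    "\<forall>i\<in>I. \<forall>x. sgn (poly (u i) x) = sgn (poly (w i) (g x))" "\<forall>z\<in>Z. g z = h z" for g
  proof
    show "sgn (poly (pderiv p) x) = sgn (poly (pderiv q) (g x))" for x
      using g(3) deriv by metis
    show "sgn (poly p z) = sgn (poly q (g z))" if "z \<in> Z" for z
      using that at_roots g(4) by (auto simp: Z_def)
  qed (use finZ g deg crit in auto)
  define C where "C = {c. poly p c = 0} - Z"
  have "p \<noteq> 0" using deg by auto
  then have finC: "finite C" by (simp add: C_def poly_roots_finite)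
  \<comment> \<open>\<open>C0\<close> holds the roots corrected so far. As \<open>g\<close> keeps
    the values of \<open>h\<close> on \<open>Z\<close>, the hypothesis \<open>at_roots\<close>,
    stated for \<open>h\<close>, stays usable after every correction.\<close>
  have "\<exists>g. strict_mono g \<and> surj g \<and> (\<forall>i\<in>I. \<forall>x. sgn (poly (u i) x) = sgn (poly (w i) (g x)))
      \<and> (\<forall>z\<in>Z. g z = h z) \<and> (\<forall>c\<in>C0. poly q (g c) = 0)" if "C0 \<subseteq> C" for C0
    using finite_subset[OF that finC] that
  proof (induction C0)
    case empty
    then show ?case using h match by (intro exI[of _ h]) auto
  next
    case (insert c C0)
    then obtain g where g: "strict_mono g" "surj g"
      "\<forall>i\<in>I. \<forall>x. sgn (poly (u i) x) = sgn (poly (w i) (g x))" "\<forall>z\<in>Z. g z = h z"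
      "\<forall>c\<in>C0. poly q (g c) = 0" by auto
    interpret sign_matching p q g Z using sm g by blast
    have c: "c \<notin> Z" "poly p c = 0" using insert.prems by (auto simp: C_def)
    obtain d where d: "poly q d = 0" "\<forall>z\<in>Z. g z < min (g c) d \<or> max (g c) d < g z"
      using matching_root[OF c] by blast
    obtain a b where ab: "a < min (g c) d" "max (g c) d < b" "\<forall>z\<in>g ` Z. z < a \<or> b < z"
      using finite_avoid_interval[of "g ` Z" "min (g c) d" "max (g c) d"] d finZ by auto
    obtain k where k: "strict_mono k" "surj k" "k (g c) = d" "\<And>x. x \<le> a \<or> b \<le> x \<Longrightarrow> k x = x"
      using strict_mono_surj_move_point[of a "g c" b d] ab by auto
    \<comment> \<open>Between two roots of \<open>p\<close> lies a critical point, whose image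
      avoids the interval from \<open>a\<close> to \<open>b\<close>. Hence images of roots corrected
      earlier lie outside and are fixed by \<open>k\<close>.\<close>
    have other: "g c' \<le> a \<or> b \<le> g c'" if "c' \<in> C0" for c'
    proof -
      have c': "c' \<noteq> c" "poly p c' = 0" using that insert by (auto simp: C_def)
      have ends: "min c c' < max c c'" "poly p (min c c') = 0" "poly p (max c c') = 0"
        using c(2) c' by (simp_all add: min_def max_def)
      then obtain z where z: "min c c' < z" "z < max c c'" "poly (pderiv p) z = 0"
        using poly_MVT[of "min c c'" "max c c'" p] by auto
      have "z \<in> Z" using crit z(3) by blast
      consider "g c < g z" "g z < g c'" | "g c' < g z" "g z < g c"
        using z(1,2) by (auto simp: h_less_iff min_def max_def split: if_splits)
      then show ?thesis using \<open>z \<in> Z\<close> ab by cases auto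
    qed
    \<comment> \<open>Every real is some \<open>g x\<close>: a vanishing \<open>u i\<close> forces
      \<open>w i\<close> to vanish, and otherwise a root of \<open>w i\<close> in the interval would
      be the image of a point of \<open>Z\<close>.\<close>
    have inside: "sgn (poly (w i) y) = sgn (poly (w i) y')"
      if "i \<in> I" "a \<le> y" "y \<le> y'" "y' \<le> b" for i y y'
    proof (cases "u i = 0")
      case True
      then have "poly (w i) y = 0" for y
        using g(2,3) that(1) by (metis poly_0 sgn_0 sgn_0_0 surjD)
      then show ?thesis by simp
    next
      case False
      have "poly (w i) v \<noteq> 0" if v: "a \<le> v" "v \<le> b" for v
      proof
        assume *: "poly (w i) v = 0"
        obtain x where x: "v = g x" using g(2) by (metis surjD)
        then have "poly (u i) x = 0" using * g(3) \<open>i \<in> I\<close> by (metis sgn_0 sgn_0_0)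
        then have "x \<in> Z" using False \<open>i \<in> I\<close> by (auto simp: Z_def)
        then show False using ab(3) x v by force
      qed
      then show ?thesis using that by (intro poly_sgn_eq_no_root) auto
    qed
    have "sgn (poly (w i) (g x)) = sgn (poly (w i) (k (g x)))" if "i \<in> I" for i x
    proof (cases "g x \<le> a \<or> b \<le> g x")
      case True
      then show ?thesis by (simp add: k)
    next
      case False
      then have "k a < k (g x)" "k (g x) < k b" using k(1) by (auto simp: strict_mono_def)
      then have "a < k (g x)" "k (g x) < b" using k(4) by auto
      then show ?thesis
      proof (cases "g x \<le> k (g x)")
        case True
        then show ?thesis by (rule inside[OF that, rotated]) (use False \<open>k (g x) < b\<close> in auto)
      next
        case 2: False
        show ?thesis by (rule inside[OF that, symmetric]) (use False 2 \<open>a < k (g x)\<close> in auto)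
      qed
    qed
    then have "\<forall>i\<in>I. \<forall>x. sgn (poly (u i) x) = sgn (poly (w i) ((k \<circ> g) x))"
      using g(3) by (metis comp_apply)
    moreover have "strict_mono (k \<circ> g)" using k g by (auto simp: strict_mono_def)
    moreover have "surj (k \<circ> g)" by (rule comp_surj[OF g(2) k(2)])
    moreover have "\<forall>z\<in>Z. (k \<circ> g) z = h z"
      using k(4) ab(3) g(4) by force
    moreover have "\<forall>c'\<in>insert c C0. poly q ((k \<circ> g) c') = 0"
      using d(1) k(3,4) other g(5) by auto
    ultimately show ?case by (intro exI[of _ "k \<circ> g"] conjI)
  qed
  from this[OF order.refl] obtain g where g: "strict_mono g" "surj g"
      "\<forall>i\<in>I. \<forall>x. sgn (poly (u i) x) = sgn (poly (w i) (g x))" "\<forall>z\<in>Z. g z = h z"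
      "\<forall>c\<in>C. poly q (g c) = 0" by (elim exE conjE)
  interpret sign_matching p q g Z using sm g by blast
  have "poly q (g c) = 0" if "poly p c = 0" for c
  proof (cases "c \<in> Z")
    case True
    then show ?thesis using sgn_Z that by (metis sgn_0 sgn_zero_iff)
  next
    case False
    then show ?thesis using g(5) that by (auto simp: C_def)
  qed
  then have "sgn (poly p x) = sgn (poly q (g x))" for x by (rule sgn_image)
  then have "\<forall>x. sgn (poly p x) = sgn (poly q (g x))" ..
  with g(1-3) show ?thesis by (intro exI[of _ g] conjI)
qed


section \<open>Semialgebraic conditions\<close>

text \<open>The only constants of the language are 0 and 1, so these are the polynomial functions
  with integer coefficients; real parameters have to enter through variables.\<close>

definition polynomial_fun :: "(('v \<Rightarrow> real) \<Rightarrow> real) \<Rightarrow> bool" where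
  "polynomial_fun g \<longleftrightarrow> (\<exists>s. \<forall>v. g v = trm_value v s)"

lemma polynomial_fun_var: "polynomial_fun (\<lambda>v. v x)"
  unfolding polynomial_fun_def by (metis trm_value.simps(1))

lemma polynomial_fun_0: "polynomial_fun (\<lambda>v. 0)"
  unfolding polynomial_fun_def by (metis trm_value.simps(2))

lemma polynomial_fun_1: "polynomial_fun (\<lambda>v. 1)"
  unfolding polynomial_fun_def by (metis trm_value.simps(3))

lemma polynomial_fun_add:
  assumes "polynomial_fun f" "polynomial_fun g"
  shows "polynomial_fun (\<lambda>v. f v + g v)"
  using assms unfolding polynomial_fun_def by (metis trm_value.simps(4))

lemma polynomial_fun_diff:
  assumes "polynomial_fun f" "polynomial_fun g"
  shows "polynomial_fun (\<lambda>v. f v - g v)"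
  using assms unfolding polynomial_fun_def by (metis trm_value.simps(5))

lemma polynomial_fun_mult:
  assumes "polynomial_fun f" "polynomial_fun g"
  shows "polynomial_fun (\<lambda>v. f v * g v)"
  using assms unfolding polynomial_fun_def by (metis trm_value.simps(6))

lemma polynomial_fun_uminus: "polynomial_fun f \<Longrightarrow> polynomial_fun (\<lambda>v. - f v)"
  using polynomial_fun_diff[OF polynomial_fun_0] by simp

lemma polynomial_fun_power: "polynomial_fun f \<Longrightarrow> polynomial_fun (\<lambda>v. f v ^ n)"
  by (induction n) (auto intro: polynomial_fun_1 polynomial_fun_mult)

lemma polynomial_fun_sum:
  "(\<And>i. i \<in> I \<Longrightarrow> polynomial_fun (f i)) \<Longrightarrow> polynomial_fun (\<lambda>v. \<Sum>i\<in>I. f i v)"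
  by (induction I rule: infinite_finite_induct) (auto intro: polynomial_fun_0 polynomial_fun_add)

lemma polynomial_fun_of_nat: "polynomial_fun (\<lambda>v. of_nat n)"
  by (induction n) (auto intro: polynomial_fun_0 polynomial_fun_1 polynomial_fun_add)

lemma polynomial_fun_of_int: "polynomial_fun (\<lambda>v. of_int k)"
  by (cases k rule: int_cases2) (auto intro: polynomial_fun_of_nat polynomial_fun_uminus)

lemmas polynomial_fun_intros = polynomial_fun_var polynomial_fun_0 polynomial_fun_1
  polynomial_fun_add polynomial_fun_diff polynomial_fun_mult polynomial_fun_uminus
  polynomial_fun_power polynomial_fun_sum polynomial_fun_of_nat polynomial_fun_of_int

text \<open>Semialgebraic over the integers. Working with predicates on valuations lets closure
  properties apply directly to HOL expressions, without building formulas.\<close>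

definition semialgebraic :: "(('v \<Rightarrow> real) \<Rightarrow> bool) \<Rightarrow> bool" where
  "semialgebraic P \<longleftrightarrow> (\<exists>\<phi>. quantifier_free \<phi> \<and> (\<forall>v. P v \<longleftrightarrow> sat UNIV (\<le>) \<phi> v))"

lemma semialgebraic_sat: "quantifier_free \<phi> \<Longrightarrow> semialgebraic (sat UNIV (\<le>) \<phi>)"
  unfolding semialgebraic_def by auto

lemma semialgebraic_eq:
  assumes "polynomial_fun f" "polynomial_fun g"
  shows "semialgebraic (\<lambda>v. f v = g v)"
proof -
  obtain s t where "\<And>v. f v = trm_value v s" "\<And>v. g v = trm_value v t"
    using assms by (auto simp: polynomial_fun_def)
  then show ?thesis unfolding semialgebraic_def by (intro exI[of _ "Eq s t"]) auto
qed

lemma semialgebraic_le: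
  assumes "polynomial_fun f" "polynomial_fun g"
  shows "semialgebraic (\<lambda>v. f v \<le> g v)"
proof -
  obtain s t where "\<And>v. f v = trm_value v s" "\<And>v. g v = trm_value v t"
    using assms by (auto simp: polynomial_fun_def)
  then show ?thesis unfolding semialgebraic_def by (intro exI[of _ "Le s t"]) auto
qed

lemma semialgebraic_not:
  assumes "semialgebraic P"
  shows "semialgebraic (\<lambda>v. \<not> P v)"
proof -
  obtain \<phi> where "quantifier_free \<phi>" "\<And>v. P v \<longleftrightarrow> sat UNIV (\<le>) \<phi> v"
    using assms by (auto simp: semialgebraic_def)
  then show ?thesis unfolding semialgebraic_def by (intro exI[of _ "Neg \<phi>"]) auto
qed

lemma semialgebraic_conj:
  assumes "semialgebraic P" "semialgebraic Q"
  shows "semialgebraic (\<lambda>v. P v \<and> Q v)"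
proof -
  obtain \<phi> \<psi> where "quantifier_free \<phi>" "\<And>v. P v \<longleftrightarrow> sat UNIV (\<le>) \<phi> v"
      "quantifier_free \<psi>" "\<And>v. Q v \<longleftrightarrow> sat UNIV (\<le>) \<psi> v"
    using assms by (auto simp: semialgebraic_def)
  then show ?thesis unfolding semialgebraic_def by (intro exI[of _ "And \<phi> \<psi>"]) auto
qed

lemma semialgebraic_disj:
  assumes "semialgebraic P" "semialgebraic Q"
  shows "semialgebraic (\<lambda>v. P v \<or> Q v)"
  using semialgebraic_not[OF semialgebraic_conj[OF semialgebraic_not[OF assms(1)] semialgebraic_not[OF assms(2)]]]
  by simp

lemma semialgebraic_less:
  assumes "polynomial_fun f" "polynomial_fun g"
  shows "semialgebraic (\<lambda>v. f v < g v)"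
  using semialgebraic_not[OF semialgebraic_le[OF assms(2,1)]] by (simp add: not_le)

lemma semialgebraic_const: "semialgebraic (\<lambda>v. c)"
  using semialgebraic_eq[OF polynomial_fun_0 polynomial_fun_0]
    semialgebraic_eq[OF polynomial_fun_0 polynomial_fun_1] by (cases c) auto

lemma semialgebraic_finite_ball:
  assumes "finite I" "\<And>i. i \<in> I \<Longrightarrow> semialgebraic (P i)"
  shows "semialgebraic (\<lambda>v. \<forall>i\<in>I. P i v)"
  using assms by (induction I) (simp_all add: semialgebraic_const semialgebraic_conj)

lemma semialgebraic_finite_bex:
  assumes "finite I" "\<And>i. i \<in> I \<Longrightarrow> semialgebraic (P i)"
  shows "semialgebraic (\<lambda>v. \<exists>i\<in>I. P i v)"
  using assms by (induction I) (simp_all add: semialgebraic_const semialgebraic_disj)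

lemma semialgebraic_sgn:
  assumes "polynomial_fun f"
  shows "semialgebraic (\<lambda>v. sgn (f v) = c)"
proof -
  have "(\<lambda>v. sgn (f v) = c) = (\<lambda>v. f v < 0 \<and> c = - 1 \<or> f v = 0 \<and> c = 0 \<or> 0 < f v \<and> c = 1)"
    by (auto simp: sgn_real_def fun_eq_iff)
  then show ?thesis
    by (simp add: semialgebraic_conj semialgebraic_disj semialgebraic_less semialgebraic_eq
        semialgebraic_const polynomial_fun_0 assms)
qed

section \<open>Substitution in quantifier-free formulas, and sign cells\<close>

primrec subst_trm :: "('u \<Rightarrow> 'v trm) \<Rightarrow> 'u trm \<Rightarrow> 'v trm" where
  "subst_trm \<sigma> (Var x) = \<sigma> x"
| "subst_trm \<sigma> Zero = Zero"
| "subst_trm \<sigma> One = One"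
| "subst_trm \<sigma> (Add s t) = Add (subst_trm \<sigma> s) (subst_trm \<sigma> t)"
| "subst_trm \<sigma> (Sub s t) = Sub (subst_trm \<sigma> s) (subst_trm \<sigma> t)"
| "subst_trm \<sigma> (Mul s t) = Mul (subst_trm \<sigma> s) (subst_trm \<sigma> t)"

text \<open>Junk on quantified formulas.\<close>

primrec subst_fm :: "('u \<Rightarrow> 'v trm) \<Rightarrow> 'u fm \<Rightarrow> 'v fm" where
  "subst_fm \<sigma> (Eq s t) = Eq (subst_trm \<sigma> s) (subst_trm \<sigma> t)"
| "subst_fm \<sigma> (Le s t) = Le (subst_trm \<sigma> s) (subst_trm \<sigma> t)"
| "subst_fm \<sigma> (Neg \<phi>) = Neg (subst_fm \<sigma> \<phi>)"
| "subst_fm \<sigma> (And \<phi> \<psi>) = And (subst_fm \<sigma> \<phi>) (subst_fm \<sigma> \<psi>)"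
| "subst_fm \<sigma> (Or \<phi> \<psi>) = Or (subst_fm \<sigma> \<phi>) (subst_fm \<sigma> \<psi>)"
| "subst_fm \<sigma> (Forall x \<phi>) = undefined"
| "subst_fm \<sigma> (Exists x \<phi>) = undefined"

lemma trm_value_subst_trm: "trm_value v (subst_trm \<sigma> s) = trm_value (\<lambda>x. trm_value v (\<sigma> x)) s"
  by (induction s) auto

lemma subst_fm:
  assumes "quantifier_free \<phi>"
  shows "quantifier_free (subst_fm \<sigma> \<phi>)"
    and "sat A le (subst_fm \<sigma> \<phi>) v \<longleftrightarrow> sat A le \<phi> (\<lambda>x. trm_value v (\<sigma> x))"
  using assms by (induction \<phi>) (auto simp: trm_value_subst_trm)

lemma semialgebraic_subst:
  assumes "semialgebraic P" "\<And>x. polynomial_fun (\<sigma> x)"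
  shows "semialgebraic (\<lambda>v. P (\<lambda>x. \<sigma> x v))"
proof -
  obtain \<phi> where \<phi>: "quantifier_free \<phi>" "\<And>v. P v \<longleftrightarrow> sat UNIV (\<le>) \<phi> v"
    using assms(1) by (auto simp: semialgebraic_def)
  obtain \<tau> where "\<And>x v. \<sigma> x v = trm_value v (\<tau> x)"
    using assms(2) unfolding polynomial_fun_def by metis
  then show ?thesis unfolding semialgebraic_def
    by (intro exI[of _ "subst_fm \<tau> \<phi>"]) (simp add: \<phi> subst_fm)
qed

text \<open>Such a predicate is a finite union of sign cells. The induction splits off one
  polynomial \<open>d\<close>: \<open>?Q c v\<close> asks for a point of \<open>P\<close> at which
  \<open>d\<close> has sign \<open>c\<close> and the remaining polynomials have the signs they have
  at \<open>v\<close>.\<close>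

lemma semialgebraic_sign_invariant:
  assumes "finite D" "\<And>d. d \<in> D \<Longrightarrow> polynomial_fun d"
    and "\<And>v w. (\<And>d. d \<in> D \<Longrightarrow> sgn (d v) = sgn (d w)) \<Longrightarrow> P v \<Longrightarrow> P w"
  shows "semialgebraic P"
  using assms
proof (induction D arbitrary: P)
  case empty
  then have "P = (\<lambda>v. \<exists>w. P w)" by blast
  then show ?case using semialgebraic_const by metis
next
  case (insert d D)
  let ?Q = "\<lambda>c v. \<exists>w. P w \<and> sgn (d w) = c \<and> (\<forall>e\<in>D. sgn (e v) = sgn (e w))"
  have Q: "semialgebraic (?Q c)" for c
  proof (rule insert.IH)
    fix v w assume "\<And>e. e \<in> D \<Longrightarrow> sgn (e v) = sgn (e w)" "?Q c v"
    then show "?Q c w" by metis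
  qed (use insert.prems in auto)
  have decomposition: "P = (\<lambda>v. \<exists>c\<in>{-1, 0, 1}. sgn (d v) = c \<and> ?Q c v)"
  proof (intro ext iffI)
    fix v assume "P v"
    moreover have "sgn (d v) \<in> {-1, 0, 1}" by (auto simp: sgn_real_def)
    ultimately show "\<exists>c\<in>{-1, 0, 1}. sgn (d v) = c \<and> ?Q c v" by blast
  next
    fix v assume "\<exists>c\<in>{-1, 0, 1}. sgn (d v) = c \<and> ?Q c v"
    then obtain w where w: "P w" "sgn (d w) = sgn (d v)" "\<forall>e\<in>D. sgn (e v) = sgn (e w)" by auto
    show "P v" by (rule insert.prems(2)[OF _ w(1)]) (metis w(2,3) insertE)
  qed
  show ?case
    by (subst decomposition, intro semialgebraic_finite_bex semialgebraic_conj semialgebraic_sgn Q)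
      (use insert.prems in auto)
qed


section \<open>Quantifier elimination\<close>

text \<open>\<open>n\<close> is a uniform formal bound. At particular parameters the true degree may
  drop, which is why later arguments branch on leading coefficients and use truncations.\<close>

definition parametric_poly :: "nat \<Rightarrow> (('v \<Rightarrow> real) \<Rightarrow> real poly) \<Rightarrow> bool" where
  "parametric_poly n F \<longleftrightarrow> (\<forall>k. polynomial_fun (\<lambda>v. coeff (F v) k)) \<and> (\<forall>v. degree (F v) \<le> n)"

lemma parametric_poly_mono: "parametric_poly m F \<Longrightarrow> m \<le> n \<Longrightarrow> parametric_poly n F"
  unfolding parametric_poly_def using order_trans by blast

lemma parametric_poly_coeff: "parametric_poly n F \<Longrightarrow> polynomial_fun (\<lambda>v. coeff (F v) k)"
  unfolding parametric_poly_def by blast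

lemma parametric_poly_degree: "parametric_poly n F \<Longrightarrow> degree (F v) \<le> n"
  unfolding parametric_poly_def by blast

lemma parametric_poly_coeff_eq_0: "parametric_poly n F \<Longrightarrow> n < k \<Longrightarrow> coeff (F v) k = 0"
  using parametric_poly_degree[of n F v] by (intro coeff_eq_0) simp

lemma parametric_poly_add:
  "parametric_poly n F \<Longrightarrow> parametric_poly n G \<Longrightarrow> parametric_poly n (\<lambda>v. F v + G v)"
  unfolding parametric_poly_def by (auto intro: polynomial_fun_add degree_add_le)

lemma parametric_poly_diff:
  "parametric_poly n F \<Longrightarrow> parametric_poly n G \<Longrightarrow> parametric_poly n (\<lambda>v. F v - G v)"
  unfolding parametric_poly_def by (auto intro: polynomial_fun_diff degree_diff_le)

lemma parametric_poly_mult: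
  assumes "parametric_poly m F" "parametric_poly n G"
  shows "parametric_poly (m + n) (\<lambda>v. F v * G v)"
  unfolding parametric_poly_def
proof (intro conjI allI)
  show "polynomial_fun (\<lambda>v. coeff (F v * G v) k)" for k
    unfolding coeff_mult
    by (intro polynomial_fun_sum polynomial_fun_mult parametric_poly_coeff[OF assms(1)]
        parametric_poly_coeff[OF assms(2)])
  show "degree (F v * G v) \<le> m + n" for v
    using degree_mult_le[of "F v" "G v"] parametric_poly_degree[OF assms(1), of v]
      parametric_poly_degree[OF assms(2), of v] by linarith
qed

lemma parametric_poly_monom:
  assumes "polynomial_fun g"
  shows "parametric_poly n (\<lambda>v. monom (g v) n)"
  unfolding parametric_poly_def
proof (intro conjI allI degree_monom_le)
  show "polynomial_fun (\<lambda>v. coeff (monom (g v) n) k)" for k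
    using assms by (cases "n = k") (simp_all add: polynomial_fun_0)
qed

lemma parametric_poly_const: "polynomial_fun g \<Longrightarrow> parametric_poly n (\<lambda>v. [:g v:])"
  using parametric_poly_monom[of g 0] parametric_poly_mono[of 0 _ n] by (simp add: monom_0)

text \<open>The variable to be eliminated becomes the indeterminate, the others become
  parameters.\<close>

lemma parametric_poly_trm_value:
  "\<exists>n F. parametric_poly n F \<and> (\<forall>v y. poly (F v) y = trm_value (v(x := y)) s)"
proof (induction s)
  case (Var z)
  show ?case
  proof (cases "z = x")
    case True
    then show ?thesis using parametric_poly_monom[OF polynomial_fun_1, of 1]
      by (intro exI[of _ 1] exI[of _ "\<lambda>v. monom 1 1"]) (auto simp: poly_monom)
  next
    case False
    then show ?thesis using parametric_poly_const[OF polynomial_fun_var, of 0 z]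
      by (intro exI[of _ 0] exI[of _ "\<lambda>v. [:v z:]"]) auto
  qed
next
  case Zero
  show ?case using parametric_poly_const[OF polynomial_fun_0, of 0]
    by (intro exI[of _ 0] exI[of _ "\<lambda>v. 0"]) auto
next
  case One
  show ?case using parametric_poly_const[OF polynomial_fun_1, of 0]
    by (intro exI[of _ 0] exI[of _ "\<lambda>v. [:1:]"]) auto
next
  case (Add s t)
  then obtain m F n G where FG: "parametric_poly m F" "\<And>v y. poly (F v) y = trm_value (v(x := y)) s"
      "parametric_poly n G" "\<And>v y. poly (G v) y = trm_value (v(x := y)) t" by blast
  show ?case
  proof (intro exI conjI allI)
    show "parametric_poly (max m n) (\<lambda>v. F v + G v)"
      by (intro parametric_poly_add parametric_poly_mono[OF FG(1)] parametric_poly_mono[OF FG(3)] max.cobounded1 max.cobounded2)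
  qed (simp only: FG poly_add trm_value.simps)
next
  case (Sub s t)
  then obtain m F n G where FG: "parametric_poly m F" "\<And>v y. poly (F v) y = trm_value (v(x := y)) s"
      "parametric_poly n G" "\<And>v y. poly (G v) y = trm_value (v(x := y)) t" by blast
  show ?case
  proof (intro exI conjI allI)
    show "parametric_poly (max m n) (\<lambda>v. F v - G v)"
      by (intro parametric_poly_diff parametric_poly_mono[OF FG(1)] parametric_poly_mono[OF FG(3)] max.cobounded1 max.cobounded2)
  qed (simp only: FG poly_diff trm_value.simps)
next
  case (Mul s t)
  then obtain m F n G where FG: "parametric_poly m F" "\<And>v y. poly (F v) y = trm_value (v(x := y)) s"
      "parametric_poly n G" "\<And>v y. poly (G v) y = trm_value (v(x := y)) t" by blast
  show ?case
  proof (intro exI conjI allI)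
    show "parametric_poly (m + n) (\<lambda>v. F v * G v)"
      by (intro parametric_poly_mult FG)
  qed (simp only: FG poly_mult trm_value.simps)
qed

lemma parametric_poly_pderiv:
  assumes "parametric_poly (Suc n) F"
  shows "parametric_poly n (\<lambda>v. pderiv (F v))"
  unfolding parametric_poly_def
proof (intro conjI allI)
  show "polynomial_fun (\<lambda>v. coeff (pderiv (F v)) k)" for k
    unfolding coeff_pderiv
    by (intro polynomial_fun_mult polynomial_fun_of_nat parametric_poly_coeff[OF assms])
  show "degree (pderiv (F v)) \<le> n" for v
    using parametric_poly_degree[OF assms, of v] by (simp add: degree_pderiv)
qed

text \<open>Truncation lowers the formal bound, and it changes nothing at exactly those parameters
  where all coefficients above index \<open>n\<close> vanish.\<close>

lemma parametric_poly_cutoff: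
  assumes "parametric_poly m F"
  shows "parametric_poly n (\<lambda>v. poly_cutoff (Suc n) (F v))"
  unfolding parametric_poly_def
proof (intro conjI allI)
  show "polynomial_fun (\<lambda>v. coeff (poly_cutoff (Suc n) (F v)) k)" for k
    using parametric_poly_coeff[OF assms]
    by (cases "k < Suc n") (simp_all add: coeff_poly_cutoff polynomial_fun_0)
  show "degree (poly_cutoff (Suc n) (F v)) \<le> n" for v
    by (intro degree_le) (simp add: coeff_poly_cutoff)
qed

text \<open>Even powers of the leading coefficient are positive, so that at the roots of \<open>G v\<close> the
  pseudo-remainder has the sign of \<open>F v\<close>.\<close>

lemma parametric_pseudo_remainder:
  assumes "parametric_poly n F" "parametric_poly (Suc m) G"
  shows "\<exists>R k. parametric_poly m R \<and>
    (\<forall>v. \<exists>Q. smult (coeff (G v) (Suc m) ^ (2 * k)) (F v) = Q * G v + R v)"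
proof (cases "n \<le> m")
  case True
  then have "\<forall>v. \<exists>Q. smult (coeff (G v) (Suc m) ^ (2 * 0)) (F v) = Q * G v + F v"
    by (auto intro: exI[of _ 0])
  then show ?thesis using parametric_poly_mono[OF assms(1) True] by blast
next
  case False
  have "\<exists>R k. parametric_poly m R \<and>
    (\<forall>v. \<exists>Q. smult (coeff (G v) (Suc m) ^ (2 * k)) (F v) = Q * G v + R v)" if "m \<le> n" "parametric_poly n F" for F
    using that
  proof (induction n arbitrary: F rule: dec_induct)
    case base
    then have "\<forall>v. \<exists>Q. smult (coeff (G v) (Suc m) ^ (2 * 0)) (F v) = Q * G v + F v"
      by (auto intro: exI[of _ 0])
    then show ?case using base by blast
  next
    case (step n)
    let ?c = "\<lambda>v. coeff (G v) (Suc m)" and ?a = "\<lambda>v. coeff (F v) (Suc n)"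
    \<comment> \<open>One division step, cancelling the coefficient at index \<open>Suc n\<close>.
      Multiplying by the square of \<open>?c v\<close> keeps the total multiplier an even
      power.\<close>
    define F1 where "F1 v = smult (?c v ^ 2) (F v) - monom (?c v * ?a v) (n - m) * G v" for v
    have co: "coeff (F1 v) k = ?c v ^ 2 * coeff (F v) k -
        (if n - m \<le> k then ?c v * ?a v * coeff (G v) (k - (n - m)) else 0)" for v k
      by (simp add: F1_def coeff_monom_mult)
    have "parametric_poly n F1" unfolding parametric_poly_def
    proof (intro conjI allI)
      have *: "polynomial_fun (\<lambda>v. coeff (F v) k)" "polynomial_fun (\<lambda>v. coeff (G v) k)" for k
        using step.prems assms(2) parametric_poly_coeff by blast+
      show "polynomial_fun (\<lambda>v. coeff (F1 v) k)" for k
        unfolding co by (cases "n - m \<le> k")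
          (auto intro!: polynomial_fun_diff polynomial_fun_mult polynomial_fun_power polynomial_fun_0 *)
      show "degree (F1 v) \<le> n" for v
      proof (intro degree_le allI impI)
        fix k assume "n < k"
        show "coeff (F1 v) k = 0"
        proof (cases "k = Suc n")
          case True
          then show ?thesis using step.hyps by (simp add: co power2_eq_square Suc_diff_le)
        next
          case False
          then have "Suc n < k" "Suc m < k - (n - m)" using \<open>n < k\<close> step.hyps by auto
          then show ?thesis unfolding co
            using parametric_poly_coeff_eq_0[OF step.prems] parametric_poly_coeff_eq_0[OF assms(2)] by simp
        qed
      qed
    qed
    then obtain R k where R: "parametric_poly m R"
      "\<And>v. \<exists>Q. smult (?c v ^ (2 * k)) (F1 v) = Q * G v + R v" using step.IH by blast
    have "\<exists>Q. smult (?c v ^ (2 * Suc k)) (F v) = Q * G v + R v" for v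
    proof -
      obtain Q where "smult (?c v ^ (2 * k)) (F1 v) = Q * G v + R v" using R(2) by blast
      then have "smult (?c v ^ (2 * k)) (smult (?c v ^ 2) (F v)) =
          (Q + smult (?c v ^ (2 * k)) (monom (?c v * ?a v) (n - m))) * G v + R v"
        by (simp add: F1_def smult_diff_right algebra_simps)
      then show ?thesis by (metis power_add mult_Suc_right add.commute smult_smult)
    qed
    then show ?case using R(1) by blast
  qed
  then show ?thesis using False assms(1) by simp
qed

section \<open>Sign diagrams determined by polynomials in the parameters\<close>

text \<open>\<open>h\<close> depends on \<open>v\<close> and \<open>w\<close> but serves all of
  \<open>P\<close> at once, so that it carries a point realizing a given combination of signs to
  another such point.\<close>

definition determines_signs :: "(('v \<Rightarrow> real) \<Rightarrow> real) set \<Rightarrow> (('v \<Rightarrow> real) \<Rightarrow> real poly) set \<Rightarrow> bool" where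
  "determines_signs D P \<longleftrightarrow> (\<forall>v w. (\<forall>d\<in>D. sgn (d v) = sgn (d w)) \<longrightarrow>
     (\<exists>h. strict_mono h \<and> surj h \<and> (\<forall>F\<in>P. \<forall>x. sgn (poly (F v) x) = sgn (poly (F w) (h x)))))"

lemma determines_signsD:
  assumes "determines_signs D P" "\<And>d. d \<in> D \<Longrightarrow> sgn (d v) = sgn (d w)"
  obtains h where "strict_mono h" "surj h" "\<And>F x. F \<in> P \<Longrightarrow> sgn (poly (F v) x) = sgn (poly (F w) (h x))"
  using assms unfolding determines_signs_def by blast

lemma determines_signs_subset:
  assumes "determines_signs D P" "P' \<subseteq> P"
  shows "determines_signs D P'"
  unfolding determines_signs_def
proof (intro allI impI)
  fix v w :: "'a \<Rightarrow> real"
  assume "\<forall>d\<in>D. sgn (d v) = sgn (d w)"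
  then obtain h where "strict_mono h" "surj h" "\<forall>F\<in>P. \<forall>x. sgn (poly (F v) x) = sgn (poly (F w) (h x))"
    using assms(1) unfolding determines_signs_def by blast
  then show "\<exists>h. strict_mono h \<and> surj h \<and> (\<forall>F\<in>P'. \<forall>x. sgn (poly (F v) x) = sgn (poly (F w) (h x)))"
    using assms(2) by (intro exI[of _ h]) blast
qed

lemma poly_cutoff_id:
  assumes "\<And>k. n \<le> k \<Longrightarrow> coeff p k = 0"
  shows "poly_cutoff n p = p"
  using assms by (intro poly_eqI) (simp add: coeff_poly_cutoff)

text \<open>If the top coefficient of \<open>p\<close> vanishes, \<open>p\<close> is its own
  truncation, which lies in \<open>P\<close>. Otherwise, at a root of a nonzero \<open>q v\<close>,
  the sign of \<open>p\<close> is that of a pseudo-remainder in \<open>P\<close>; so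
  \<open>h\<close> already matches \<open>p\<close> there and can be corrected elsewhere. One
  remainder \<open>R q j\<close> is supplied for each possible true degree \<open>Suc j\<close> of
  \<open>q v\<close>.\<close>

lemma determines_signs_extend:
  assumes p: "parametric_poly (Suc n) p" and Q: "finite Q" "\<And>q. q \<in> Q \<Longrightarrow> parametric_poly (Suc n) q"
    and deriv: "(\<lambda>v. pderiv (p v)) \<in> Q"
    and R: "\<And>q j. q \<in> Q \<Longrightarrow> j \<le> n \<Longrightarrow> \<exists>k. \<forall>v. \<exists>T.
        smult (coeff (q v) (Suc j) ^ (2 * k)) (p v) = T * poly_cutoff (Suc (Suc j)) (q v) + R q j v"
    and P: "Q \<subseteq> P" "(\<lambda>v. poly_cutoff (Suc n) (p v)) \<in> P" "\<And>q j. q \<in> Q \<Longrightarrow> j \<le> n \<Longrightarrow> R q j \<in> P"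
    and D: "determines_signs D P" "D \<subseteq> D'" "(\<lambda>v. coeff (p v) (Suc n)) \<in> D'"
      "\<And>q j. q \<in> Q \<Longrightarrow> j \<le> Suc n \<Longrightarrow> (\<lambda>v. coeff (q v) j) \<in> D'"
  shows "determines_signs D' (insert p Q)"
  unfolding determines_signs_def
proof (intro allI impI)
  fix v w :: "'a \<Rightarrow> real"
  assume sgn: "\<forall>d\<in>D'. sgn (d v) = sgn (d w)"
  obtain h where h: "strict_mono h" "surj h" "\<And>F x. F \<in> P \<Longrightarrow> sgn (poly (F v) x) = sgn (poly (F w) (h x))"
    using determines_signsD[OF D(1)] sgn D(2) by (metis subsetD)
  have lc: "coeff (p v) (Suc n) = 0 \<longleftrightarrow> coeff (p w) (Suc n) = 0"
    using sgn D(3) by (metis (no_types, lifting) sgn_zero_iff)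
  show "\<exists>h. strict_mono h \<and> surj h \<and> (\<forall>F\<in>insert p Q. \<forall>x. sgn (poly (F v) x) = sgn (poly (F w) (h x)))"
  proof (cases "coeff (p v) (Suc n) = 0")
    case True
    have "poly_cutoff (Suc n) (p u) = p u" if "coeff (p u) (Suc n) = 0" for u
    proof (rule poly_cutoff_id)
      show "coeff (p u) k = 0" if "Suc n \<le> k" for k
        using that \<open>coeff (p u) (Suc n) = 0\<close> parametric_poly_coeff_eq_0[OF p, of k u]
        by (cases "k = Suc n") auto
    qed
    then have "sgn (poly (p v) x) = sgn (poly (p w) (h x))" for x
      using h(3)[OF P(2)] True lc by simp
    then show ?thesis using h P(1) by (metis insertE subsetD)
  next
    case False
    have deg: "degree (p u) > 0" if "coeff (p u) (Suc n) \<noteq> 0" for u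
      using le_degree[OF that] by simp
    have roots: "sgn (poly (p v) z) = sgn (poly (p w) (h z))"
      if q: "q \<in> Q" "q v \<noteq> 0" "poly (q v) z = 0" for q z
    proof -
      have "degree (q v) \<noteq> 0" using q(2,3) by (metis degree_eq_zeroE poly_pCons poly_0 mult_zero_right add.right_neutral pCons_0_0)
      then obtain j where j: "degree (q v) = Suc j" by (cases "degree (q v)") auto
      then have "j \<le> n" using parametric_poly_degree[OF Q(2)[OF q(1)], of v] by simp
      \<comment> \<open>Equal signs of all coefficients give \<open>q\<close> the same true degree
        \<open>Suc j\<close> at \<open>v\<close> and at \<open>w\<close>, so the same truncation and
        the same remainder apply to both.\<close>
      have coeff_sgn: "sgn (coeff (q v) k) = sgn (coeff (q w) k)" for k
        using sgn D(4)[OF q(1), of k] parametric_poly_coeff_eq_0[OF Q(2)[OF q(1)], of k]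
        by (cases "k \<le> Suc n") (auto simp: not_le)
      have vc: "coeff (q v) (Suc j) \<noteq> 0" using j q(2) by (metis leading_coeff_neq_0)
      then have wc: "coeff (q w) (Suc j) \<noteq> 0" using coeff_sgn by (metis sgn_zero_iff)
      have v0: "coeff (q v) k = 0" if "Suc (Suc j) \<le> k" for k
        using that j by (intro coeff_eq_0) simp
      then have w0: "coeff (q w) k = 0" if "Suc (Suc j) \<le> k" for k
        using coeff_sgn that by (metis sgn_zero_iff)
      have "sgn (poly (q w) (h z)) = 0" using h(3)[of q z] q P(1) by auto
      then have "poly (q w) (h z) = 0" by (simp add: sgn_zero_iff)
      obtain k where k: "\<And>v. \<exists>T. smult (coeff (q v) (Suc j) ^ (2 * k)) (p v) =
          T * poly_cutoff (Suc (Suc j)) (q v) + R q j v"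
        using R[OF q(1) \<open>j \<le> n\<close>] by blast
      have rem: "sgn (poly (p u) y) = sgn (poly (R q j u) y)"
        if u: "poly_cutoff (Suc (Suc j)) (q u) = q u" "poly (q u) y = 0" "coeff (q u) (Suc j) \<noteq> 0" for u y
      proof -
        obtain T where "smult (coeff (q u) (Suc j) ^ (2 * k)) (p u) = T * q u + R q j u"
          using k[of u] u(1) by auto
        then have "coeff (q u) (Suc j) ^ (2 * k) * poly (p u) y = poly (R q j u) y"
          using u(2) by (metis add.left_neutral mult_zero_right poly_add poly_mult poly_smult)
        moreover have "0 < coeff (q u) (Suc j) ^ (2 * k)" using u(3) by (simp add: zero_less_power_eq power_mult)
        ultimately show ?thesis by (metis mult.left_neutral sgn_mult sgn_pos)
      qed
      have "sgn (poly (p v) z) = sgn (poly (R q j v) z)"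
        using rem poly_cutoff_id v0 q(3) vc by blast
      also have "\<dots> = sgn (poly (R q j w) (h z))" using h(3) P(3) q(1) \<open>j \<le> n\<close> by blast
      also have "\<dots> = sgn (poly (p w) (h z))"
        using rem poly_cutoff_id w0 \<open>poly (q w) (h z) = 0\<close> wc by metis
      finally show ?thesis .
    qed
    have "\<exists>h'. strict_mono h' \<and> surj h' \<and>
        (\<forall>q\<in>Q. \<forall>x. sgn (poly (q v) x) = sgn (poly (q w) (h' x))) \<and>
        (\<forall>x. sgn (poly (p v) x) = sgn (poly (p w) (h' x)))"
    proof (rule extend_sign_matching[OF Q(1) h(1,2), where u = "\<lambda>q. q v" and w = "\<lambda>q. q w"])
      show "sgn (poly (q v) x) = sgn (poly (q w) (h x))" if "q \<in> Q" for q x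
        using that h(3) P(1) by blast
      show "degree (p v) > 0" "degree (p w) > 0" using deg False lc by blast+
    qed (use deriv in \<open>simp_all add: roots\<close>)
    then show ?thesis by auto
  qed
qed

text \<open>Nested inductions, the outer one on the degree bound, the inner one on the set
  \<open>A\<close> of members with bound \<open>Suc n\<close>. Removing a member of \<open>A\<close>
  introduces its derivative, its truncation and remainders, all with bound \<open>n\<close>; hence
  \<open>B\<close> is arbitrary in the inner induction.\<close>

lemma determines_signs_exists:
  fixes P :: "(('v \<Rightarrow> real) \<Rightarrow> real poly) set"
  assumes "finite P" "\<And>F. F \<in> P \<Longrightarrow> parametric_poly n F"
  shows "\<exists>D. finite D \<and> (\<forall>d\<in>D. polynomial_fun d) \<and> determines_signs D P"
  using assms
proof (induction n arbitrary: P)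
  case 0
  let ?D = "(\<lambda>F v. coeff (F v) 0) ` P"
  have const: "poly (F v) x = coeff (F v) 0" if "F \<in> P" for F v x
    using parametric_poly_degree[OF "0.prems"(2)[OF that], of v]
    by (metis degree_eq_zeroE le_zero_eq mult_zero_right add.right_neutral poly_0 poly_pCons coeff_pCons_0)
  have "determines_signs ?D P"
    unfolding determines_signs_def
  proof (intro allI impI)
    fix v w :: "'v \<Rightarrow> real" assume *: "\<forall>d\<in>?D. sgn (d v) = sgn (d w)"
    show "\<exists>h. strict_mono h \<and> surj h \<and> (\<forall>F\<in>P. \<forall>x. sgn (poly (F v) x) = sgn (poly (F w) (h x)))"
      using * by (intro exI[of _ "\<lambda>x. x"]) (simp add: const strict_mono_def)
  qed
  then show ?case using 0 parametric_poly_coeff by (intro exI[of _ ?D]) auto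
next
  case (Suc n)
  have "\<exists>D. finite D \<and> (\<forall>d\<in>D. polynomial_fun d) \<and> determines_signs D (A \<union> B)"
    if "finite A" "\<And>F. F \<in> A \<Longrightarrow> parametric_poly (Suc n) F"
      "finite B" "\<And>F. F \<in> B \<Longrightarrow> parametric_poly n F" for A B :: "(('v \<Rightarrow> real) \<Rightarrow> real poly) set"
    using that
  proof (induction A arbitrary: B)
    case empty
    then show ?case using Suc.IH[of B] by simp
  next
    case (insert p A)
    \<comment> \<open>All of these act as divisors: the sign of \<open>p\<close> must be known at
      the roots of every polynomial whose matching is to be preserved.\<close>
    define Q where "Q = A \<union> B \<union> {\<lambda>v. pderiv (p v)}"
    have p: "parametric_poly (Suc n) p" using insert.prems by blast
    have finQ: "finite Q" using insert by (simp add: Q_def)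
    have deriv: "parametric_poly n (\<lambda>v. pderiv (p v))" using parametric_poly_pderiv[OF p] .
    then have Q: "parametric_poly (Suc n) q" if "q \<in> Q" for q
      using that insert.prems parametric_poly_mono[of n _ "Suc n"] by (auto simp: Q_def)
    have "\<exists>R. parametric_poly n R \<and> (\<exists>k. \<forall>v. \<exists>T.
        smult (coeff (q v) (Suc j) ^ (2 * k)) (p v) = T * poly_cutoff (Suc (Suc j)) (q v) + R v)"
      if q: "q \<in> Q" "j \<le> n" for q j
    proof -
      have "coeff (poly_cutoff (Suc (Suc j)) (q v)) (Suc j) = coeff (q v) (Suc j)" for v
        by (simp add: coeff_poly_cutoff)
      then obtain R k where "parametric_poly j R" "\<And>v. \<exists>T.
          smult (coeff (q v) (Suc j) ^ (2 * k)) (p v) = T * poly_cutoff (Suc (Suc j)) (q v) + R v"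
        using parametric_pseudo_remainder[OF p parametric_poly_cutoff[OF Q[OF q(1)], of "Suc j"]] by auto
      then show ?thesis using parametric_poly_mono[OF _ q(2)] by blast
    qed
    then obtain R where R: "\<And>q j. q \<in> Q \<Longrightarrow> j \<le> n \<Longrightarrow> parametric_poly n (R q j)"
      "\<And>q j. q \<in> Q \<Longrightarrow> j \<le> n \<Longrightarrow> \<exists>k. \<forall>v. \<exists>T.
        smult (coeff (q v) (Suc j) ^ (2 * k)) (p v) = T * poly_cutoff (Suc (Suc j)) (q v) + R q j v"
      by metis
    define B' where "B' = B \<union> {\<lambda>v. pderiv (p v), \<lambda>v. poly_cutoff (Suc n) (p v)} \<union>
      (\<lambda>(q, j). R q j) ` (Q \<times> {..n})"
    have "finite B'" using insert finQ by (simp add: B'_def)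
    moreover have "parametric_poly n F" if "F \<in> B'" for F
      using that insert.prems deriv parametric_poly_cutoff[OF p] R(1) by (auto simp: B'_def)
    ultimately obtain D where D: "finite D" "\<forall>d\<in>D. polynomial_fun d" "determines_signs D (A \<union> B')"
      using insert.IH[of B'] insert.prems by blast
    define D' where "D' = D \<union> {\<lambda>v. coeff (p v) (Suc n)} \<union> (\<lambda>(q, j) v. coeff (q v) j) ` (Q \<times> {..Suc n})"
    have "determines_signs D' (insert p Q)"
    proof (rule determines_signs_extend[OF p finQ Q _ R(2) _ _ _ D(3)])
      show "(\<lambda>v. coeff (q v) j) \<in> D'" if "q \<in> Q" "j \<le> Suc n" for q j
        using that unfolding D'_def by (intro UnI2 image_eqI[of _ _ "(q, j)"]) auto
      show "R q j \<in> A \<union> B'" if "q \<in> Q" "j \<le> n" for q j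
        using that unfolding B'_def by (intro UnI2 image_eqI[of _ _ "(q, j)"]) auto
    qed (auto simp: Q_def B'_def D'_def)
    then have "determines_signs D' (insert p A \<union> B)"
      by (rule determines_signs_subset) (auto simp: Q_def)
    moreover have "finite D'" "\<forall>d\<in>D'. polynomial_fun d"
      using D finQ parametric_poly_coeff[OF p] parametric_poly_coeff[OF Q] by (auto simp: D'_def)
    ultimately show ?case by blast
  qed
  from this[of P "{}"] show ?case using Suc.prems by simp
qed

section \<open>Projection of semialgebraic conditions\<close>

text \<open>The signs of these terms decide every atom, hence the truth of a quantifier-free
  formula.\<close>

primrec atom_diffs :: "'v fm \<Rightarrow> 'v trm set" where
  "atom_diffs (Eq s t) = {Sub s t}"
| "atom_diffs (Le s t) = {Sub s t}"
| "atom_diffs (Neg \<phi>) = atom_diffs \<phi>"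
| "atom_diffs (And \<phi> \<psi>) = atom_diffs \<phi> \<union> atom_diffs \<psi>"
| "atom_diffs (Or \<phi> \<psi>) = atom_diffs \<phi> \<union> atom_diffs \<psi>"
| "atom_diffs (Forall x \<phi>) = atom_diffs \<phi>"
| "atom_diffs (Exists x \<phi>) = atom_diffs \<phi>"

lemma finite_atom_diffs: "finite (atom_diffs \<phi>)"
  by (induction \<phi>) auto

lemma sat_cong_sgn:
  fixes v w :: "'v \<Rightarrow> real"
  assumes "quantifier_free \<phi>" "\<And>s. s \<in> atom_diffs \<phi> \<Longrightarrow> sgn (trm_value v s) = sgn (trm_value w s)"
  shows "sat UNIV (\<le>) \<phi> v \<longleftrightarrow> sat UNIV (\<le>) \<phi> w"
  using assms
proof (induction \<phi>)
  case (Eq s t)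
  then show ?case by (auto simp: sgn_real_def split: if_splits)
next
  case (Le s t)
  then show ?case by (auto simp: sgn_real_def split: if_splits)
qed auto

text \<open>When the polynomials in \<open>D\<close> have the same signs at \<open>v\<close> and
  \<open>w\<close>, a witness \<open>y\<close> for \<open>v\<close> is carried to the witness
  \<open>h y\<close> for \<open>w\<close>. The projection is therefore a union of sign cells of
  \<open>D\<close>.\<close>

lemma semialgebraic_exists:
  assumes "semialgebraic P"
  shows "semialgebraic (\<lambda>v. \<exists>y. P (v(x := y)))"
proof -
  obtain \<phi> where \<phi>: "quantifier_free \<phi>" "\<And>v. P v \<longleftrightarrow> sat UNIV (\<le>) \<phi> v"
    using assms by (auto simp: semialgebraic_def)
  have "\<forall>s. \<exists>nF. parametric_poly (fst nF) (snd nF) \<and> (\<forall>v y. poly (snd nF v) y = trm_value (v(x := y)) s)"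
    using parametric_poly_trm_value[of x] by (intro allI) (simp only: split_paired_Ex fst_conv snd_conv)
  then obtain nF where nF: "\<forall>s. parametric_poly (fst (nF s)) (snd (nF s)) \<and>
      (\<forall>v y. poly (snd (nF s) v) y = trm_value (v(x := y)) s)"
    by (rule exE[OF choice])
  define N where "N s = fst (nF s)" for s
  define F where "F s = snd (nF s)" for s
  have F: "parametric_poly (N s) (F s)" "poly (F s v) y = trm_value (v(x := y)) s" for s v y
    using nF by (simp_all only: N_def F_def)
  define n where "n = Max (insert 0 (N ` atom_diffs \<phi>))"
  have "parametric_poly n (F s)" if "s \<in> atom_diffs \<phi>" for s
    by (rule parametric_poly_mono[OF F(1)]) (use finite_atom_diffs that in \<open>auto simp: n_def intro!: Max_ge\<close>)
  then obtain D where D: "finite D" "\<forall>d\<in>D. polynomial_fun d" "determines_signs D (F ` atom_diffs \<phi>)"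
    using determines_signs_exists[of "F ` atom_diffs \<phi>" n] finite_atom_diffs by blast
  show ?thesis
  proof (rule semialgebraic_sign_invariant[OF D(1)])
    fix v w :: "'a \<Rightarrow> real"
    assume sgn: "\<And>d. d \<in> D \<Longrightarrow> sgn (d v) = sgn (d w)" and "\<exists>y. P (v(x := y))"
    then obtain y where y: "P (v(x := y))" by blast
    obtain h where "\<And>G y. G \<in> F ` atom_diffs \<phi> \<Longrightarrow> sgn (poly (G v) y) = sgn (poly (G w) (h y))"
      by (rule determines_signsD[OF D(3), of v w]) (blast intro: sgn)+
    then have "sgn (trm_value (v(x := y)) s) = sgn (trm_value (w(x := h y)) s)" if "s \<in> atom_diffs \<phi>" for s
      using F(2) that by (metis image_eqI)
    then show "\<exists>y. P (w(x := y))" using sat_cong_sgn[OF \<phi>(1)] \<phi>(2) y by blast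
  qed (use D in auto)
qed

text \<open>A block of existential quantifiers over the variables in \<open>X\<close>, in a form
  that avoids iterated updates of the valuation.\<close>

lemma semialgebraic_exists_finite:
  assumes "finite X" "semialgebraic P"
  shows "semialgebraic (\<lambda>v. \<exists>u. (\<forall>x. x \<notin> X \<longrightarrow> u x = v x) \<and> P u)"
  using assms(1)
proof (induction X)
  case empty
  have "(\<lambda>v. \<exists>u. (\<forall>x. x \<notin> {} \<longrightarrow> u x = v x) \<and> P u) = P" by (auto simp: fun_eq_iff[symmetric])
  then show ?case using assms(2) by simp
next
  case (insert z X)
  have *: "(\<lambda>v. \<exists>u. (\<forall>x. x \<notin> insert z X \<longrightarrow> u x = v x) \<and> P u) =
      (\<lambda>v. \<exists>y. \<exists>u. (\<forall>x. x \<notin> X \<longrightarrow> u x = (v(z := y)) x) \<and> P u)"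
    (is "?L = ?R")
  proof (intro ext iffI)
    fix v assume "?L v"
    then obtain u where "\<forall>x. x \<notin> insert z X \<longrightarrow> u x = v x" "P u" by blast
    then show "?R v" by (intro exI[of _ "u z"] exI[of _ u]) auto
  next
    fix v assume "?R v"
    then obtain y u where u: "\<forall>x. x \<notin> X \<longrightarrow> u x = (v(z := y)) x" "P u" by blast
    then have "\<forall>x. x \<notin> insert z X \<longrightarrow> u x = v x" by simp
    with u(2) show "?L v" by blast
  qed
  show ?case unfolding * by (rule semialgebraic_exists[OF insert.IH])
qed


section \<open>Puiseux polynomials at infinity\<close>

lemma poly_mapping_add_induct [case_names zero add]:
  fixes p :: "'k \<Rightarrow>\<^sub>0 'b::comm_monoid_add"
  assumes "P 0" and "\<And>k a p. P p \<Longrightarrow> P (Poly_Mapping.single k a + p)"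
  shows "P p"
proof -
  have "P (\<Sum>k\<in>K. Poly_Mapping.single k (Poly_Mapping.lookup p k))" if "finite K" for K
    using that by (induction K) (simp_all add: assms)
  moreover have "p = (\<Sum>k\<in>Poly_Mapping.keys p. Poly_Mapping.single k (Poly_Mapping.lookup p k))"
  proof (rule poly_mapping_eqI)
    fix j
    have "(\<Sum>k\<in>Poly_Mapping.keys p. Poly_Mapping.lookup (Poly_Mapping.single k (Poly_Mapping.lookup p k)) j) =
        (\<Sum>k\<in>Poly_Mapping.keys p. if k = j then Poly_Mapping.lookup p k else 0)"
      by (intro sum.cong) (auto simp: lookup_single)
    then show "Poly_Mapping.lookup p j =
        Poly_Mapping.lookup (\<Sum>k\<in>Poly_Mapping.keys p. Poly_Mapping.single k (Poly_Mapping.lookup p k)) j"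
      by (simp add: lookup_sum in_keys_iff)
  qed
  ultimately show ?thesis by (metis finite_keys)
qed

text \<open>Covers two evaluations: Puiseux polynomials at a fixed \<open>t > 0\<close>, and
  rational polynomials in several variables at a real point.\<close>

locale monomial_evaluation =
  fixes c :: "'b::comm_ring_1 \<Rightarrow> real" and h :: "'k::comm_monoid_add \<Rightarrow> real"
  assumes c_add: "c (a + b) = c a + c b" and c_mult: "c (a * b) = c a * c b"
    and h_add: "h (k + l) = h k * h l"
begin

definition eval :: "('k \<Rightarrow>\<^sub>0 'b) \<Rightarrow> real" where
  "eval p = (\<Sum>k\<in>Poly_Mapping.keys p. c (Poly_Mapping.lookup p k) * h k)"

lemma c_0: "c 0 = 0"
  using c_add[of 0 0] by simp

lemma eval_superset:
  assumes "finite K" "Poly_Mapping.keys p \<subseteq> K"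
  shows "eval p = (\<Sum>k\<in>K. c (Poly_Mapping.lookup p k) * h k)"
  unfolding eval_def using assms by (intro sum.mono_neutral_left) (auto simp: in_keys_iff c_0)

lemma eval_0: "eval 0 = 0"
  by (simp add: eval_def)

lemma eval_single: "eval (Poly_Mapping.single k a) = c a * h k"
  by (subst eval_superset[of "{k}"]) (auto simp: lookup_single)

lemma eval_add: "eval (p + q) = eval p + eval q"
proof -
  let ?K = "Poly_Mapping.keys p \<union> Poly_Mapping.keys q"
  have "eval (p + q) = (\<Sum>k\<in>?K. c (Poly_Mapping.lookup (p + q) k) * h k)"
    by (rule eval_superset) (use keys_add[of p q] in auto)
  also have "\<dots> = eval p + eval q"
    by (simp add: eval_superset[of ?K p] eval_superset[of ?K q] lookup_add c_add distrib_right sum.distrib)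
  finally show ?thesis .
qed

lemma eval_diff: "eval (p - q) = eval p - eval q"
  using eval_add[of "p - q" q] by simp

lemma eval_mult: "eval (p * q) = eval p * eval q"
proof -
  have single: "eval (Poly_Mapping.single k a * q) = c a * h k * eval q" for k a
    by (induction q rule: poly_mapping_add_induct)
      (simp_all add: eval_0 eval_add eval_single distrib_left mult_single c_mult h_add)
  show ?thesis
    by (induction p rule: poly_mapping_add_induct)
      (simp_all add: eval_0 eval_add eval_single distrib_right single)
qed

end

lemma monomial_evaluation_powr:
  assumes "t > 0"
  shows "monomial_evaluation (\<lambda>a. a) (\<lambda>q. t powr of_rat q)"
  by unfold_locales (simp_all add: of_rat_add powr_add)

lemma puiseux_value_eval:
  "t > 0 \<Longrightarrow> puiseux_value p t = monomial_evaluation.eval (\<lambda>a. a) (\<lambda>q. t powr of_rat q) p"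
  by (simp add: puiseux_value_def monomial_evaluation.eval_def[OF monomial_evaluation_powr])

lemma puiseux_value_diff: "t > 0 \<Longrightarrow> puiseux_value (p - q) t = puiseux_value p t - puiseux_value q t"
  by (simp add: puiseux_value_eval monomial_evaluation.eval_diff[OF monomial_evaluation_powr])

lemma puiseux_value_trm_value:
  assumes "t > 0"
  shows "puiseux_value (trm_value v s) t = trm_value (\<lambda>x. puiseux_value (v x) t) s"
proof -
  interpret monomial_evaluation "\<lambda>a. a" "\<lambda>q. t powr of_rat q"
    using monomial_evaluation_powr[OF assms] .
  have "eval 1 = 1" using eval_single[of 0 1] assms by (simp add: single_one)
  then show ?thesis
    by (induction s) (simp_all add: puiseux_value_eval[OF assms] eval_0 eval_add eval_diff eval_mult)
qed

section \<open>Growth of Puiseux polynomials\<close>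

text \<open>After division by the leading power every other term has a negative exponent and tends
  to 0.\<close>

lemma puiseux_value_asymp:
  assumes "p \<noteq> 0"
  shows "((\<lambda>t. puiseux_value p t / t powr of_rat (Max (Poly_Mapping.keys p))) \<longlongrightarrow> puiseux_lead_coeff p) at_top"
proof -
  let ?m = "Max (Poly_Mapping.keys p)"
  have summand: "((\<lambda>t. Poly_Mapping.lookup p q * t powr (of_rat q - of_rat ?m)) \<longlongrightarrow>
      (if q = ?m then Poly_Mapping.lookup p q else 0)) at_top" if "q \<in> Poly_Mapping.keys p" for q
  proof (cases "q = ?m")
    case True
    have "\<forall>\<^sub>F t in at_top. Poly_Mapping.lookup p q * t powr (of_rat q - of_rat ?m) = Poly_Mapping.lookup p q"
      using eventually_gt_at_top[of "0::real"] by eventually_elim (use True in simp)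
    then show ?thesis using True by (simp add: tendsto_eventually)
  next
    case False
    then have "q < ?m" using that by (simp add: order_le_neq_trans)
    then have "(of_rat q - of_rat ?m :: real) < 0" by (simp add: of_rat_less)
    then have "((\<lambda>t. Poly_Mapping.lookup p q * t powr (of_rat q - of_rat ?m)) \<longlongrightarrow> Poly_Mapping.lookup p q * 0) at_top"
      by (intro tendsto_mult tendsto_const tendsto_neg_powr filterlim_ident)
    then show ?thesis using False by simp
  qed
  have "?m \<in> Poly_Mapping.keys p" using assms by (intro Max_in) auto
  then have "(\<Sum>q\<in>Poly_Mapping.keys p. if q = ?m then Poly_Mapping.lookup p q else 0) = puiseux_lead_coeff p"
    by (simp add: puiseux_lead_coeff_def)
  moreover have "((\<lambda>t. \<Sum>q\<in>Poly_Mapping.keys p. Poly_Mapping.lookup p q * t powr (of_rat q - of_rat ?m)) \<longlongrightarrow>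
      (\<Sum>q\<in>Poly_Mapping.keys p. if q = ?m then Poly_Mapping.lookup p q else 0)) at_top"
    by (intro tendsto_sum summand)
  ultimately have "((\<lambda>t. \<Sum>q\<in>Poly_Mapping.keys p.
      Poly_Mapping.lookup p q * t powr (of_rat q - of_rat ?m)) \<longlongrightarrow> puiseux_lead_coeff p) at_top"
    by metis
  moreover have "\<forall>\<^sub>F t in at_top. (\<Sum>q\<in>Poly_Mapping.keys p. Poly_Mapping.lookup p q * t powr (of_rat q - of_rat ?m)) =
      puiseux_value p t / t powr of_rat ?m"
    by (simp add: puiseux_value_def powr_diff sum_divide_distrib)
  ultimately show ?thesis by (rule Lim_transform_eventually)
qed

lemma puiseux_lead_coeff_nonzero: "p \<noteq> 0 \<Longrightarrow> puiseux_lead_coeff p \<noteq> 0"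
  unfolding puiseux_lead_coeff_def using Max_in[of "Poly_Mapping.keys p"] by (simp add: in_keys_iff)

lemma eventually_sgn_puiseux_value:
  assumes "p \<noteq> 0"
  shows "\<forall>\<^sub>F t in at_top. sgn (puiseux_value p t) = sgn (puiseux_lead_coeff p)"
proof -
  let ?g = "\<lambda>t. puiseux_value p t / t powr of_rat (Max (Poly_Mapping.keys p))"
  have pos: "\<forall>\<^sub>F t::real in at_top. 0 < t" by (rule eventually_gt_at_top)
  show ?thesis
  proof (cases "puiseux_lead_coeff p > 0")
    case True
    have "\<forall>\<^sub>F t in at_top. 0 < ?g t" using order_tendstoD(1)[OF puiseux_value_asymp[OF assms] True] .
    with pos show ?thesis by eventually_elim (use True in \<open>simp add: zero_less_divide_iff\<close>)
  next
    case False
    then have *: "puiseux_lead_coeff p < 0" using puiseux_lead_coeff_nonzero[OF assms] by linarith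
    have "\<forall>\<^sub>F t in at_top. ?g t < 0" using order_tendstoD(2)[OF puiseux_value_asymp[OF assms] *] .
    with pos show ?thesis by eventually_elim (use * in \<open>simp add: divide_less_0_iff\<close>)
  qed
qed

text \<open>Nonnegative exponents and non-constancy make the leading exponent positive.\<close>

lemma puiseux_value_unbounded:
  assumes "p \<in> puiseux_polynomials" "\<not> puiseux_const p"
  shows "filterlim (\<lambda>t. \<bar>puiseux_value p t\<bar>) at_top at_top"
proof -
  let ?m = "Max (Poly_Mapping.keys p)"
  have "p \<noteq> 0" using assms(2) unfolding puiseux_const_def by (metis single_zero)
  then have max: "?m \<in> Poly_Mapping.keys p" by (intro Max_in) auto
  have "?m \<noteq> 0"
  proof
    assume "?m = 0"
    then have "q = 0" if "q \<in> Poly_Mapping.keys p" for q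
      using that assms(1) Max_ge[of "Poly_Mapping.keys p" q] by (force simp: puiseux_polynomials_def)
    then have "p = Poly_Mapping.single 0 (Poly_Mapping.lookup p 0)"
      by (intro poly_mapping_eqI) (metis in_keys_iff lookup_single_eq lookup_single_not_eq)
    then show False using assms(2) unfolding puiseux_const_def by metis
  qed
  then have "0 < ?m" using max assms(1) by (auto simp: puiseux_polynomials_def order_less_le)
  then have "((\<lambda>t::real. t powr - of_rat ?m) \<longlongrightarrow> 0) at_top"
    by (intro tendsto_neg_powr filterlim_ident) simp
  then have "filterlim (\<lambda>t::real. inverse (t powr - of_rat ?m)) at_top at_top"
    using eventually_gt_at_top[of "0::real"]
    by (intro filterlim_inverse_at_top) (auto elim: eventually_mono)
  then have "filterlim (\<lambda>t::real. t powr of_rat ?m) at_top at_top"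
    by (simp add: powr_minus)
  moreover have "((\<lambda>t. \<bar>puiseux_value p t / t powr of_rat ?m\<bar>) \<longlongrightarrow> \<bar>puiseux_lead_coeff p\<bar>) at_top"
    by (intro tendsto_rabs puiseux_value_asymp \<open>p \<noteq> 0\<close>)
  ultimately have "filterlim (\<lambda>t. \<bar>puiseux_value p t / t powr of_rat ?m\<bar> * t powr of_rat ?m) at_top at_top"
    using puiseux_lead_coeff_nonzero[OF \<open>p \<noteq> 0\<close>] by (intro filterlim_tendsto_pos_mult_at_top) auto
  moreover have "\<forall>\<^sub>F t in at_top. \<bar>puiseux_value p t / t powr of_rat ?m\<bar> * t powr of_rat ?m = \<bar>puiseux_value p t\<bar>"
    using eventually_gt_at_top[of "0::real"] by eventually_elim (simp add: abs_divide)
  ultimately show ?thesis by (rule filterlim_cong[THEN iffD1, rotated -1, OF _ refl refl])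
qed

text \<open>As exponents are nonnegative, each power is largest at \<open>N\<close>. Consequently a
  large value on the curve forces a large \<open>t\<close>.\<close>

lemma puiseux_value_bounded:
  assumes "p \<in> puiseux_polynomials"
  shows "\<exists>B. \<forall>t. 1 \<le> t \<and> t \<le> N \<longrightarrow> \<bar>puiseux_value p t\<bar> \<le> B"
proof (intro exI allI impI)
  fix t assume t: "1 \<le> t \<and> t \<le> N"
  have "\<bar>puiseux_value p t\<bar> \<le> (\<Sum>q\<in>Poly_Mapping.keys p. \<bar>Poly_Mapping.lookup p q * t powr of_rat q\<bar>)"
    unfolding puiseux_value_def by (rule sum_abs)
  also have "\<dots> \<le> (\<Sum>q\<in>Poly_Mapping.keys p. \<bar>Poly_Mapping.lookup p q\<bar> * N powr of_rat q)"
    using t assms by (intro sum_mono) (auto simp: abs_mult puiseux_polynomials_def intro!: mult_left_mono powr_mono2)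
  finally show "\<bar>puiseux_value p t\<bar> \<le> (\<Sum>q\<in>Poly_Mapping.keys p. \<bar>Poly_Mapping.lookup p q\<bar> * N powr of_rat q)" .
qed

section \<open>The ordered ring as behaviour for large arguments\<close>

lemma eventually_puiseux_eq:
  "\<forall>\<^sub>F t in at_top. p = q \<longleftrightarrow> puiseux_value p t = puiseux_value q t"
proof (cases "p = q")
  case False
  then have "q - p \<noteq> 0" by simp
  from eventually_sgn_puiseux_value[OF this] eventually_gt_at_top[of 0] show ?thesis
    by eventually_elim (use False puiseux_lead_coeff_nonzero[OF \<open>q - p \<noteq> 0\<close>] in
      \<open>auto simp: puiseux_value_diff sgn_zero_iff\<close>)
qed simp

lemma eventually_puiseux_le:
  "\<forall>\<^sub>F t in at_top. puiseux_le p q \<longleftrightarrow> puiseux_value p t \<le> puiseux_value q t"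
proof (cases "p = q")
  case False
  then have "q - p \<noteq> 0" by simp
  from eventually_sgn_puiseux_value[OF this] eventually_gt_at_top[of 0] show ?thesis
  proof eventually_elim
    case (elim t)
    then have "puiseux_lead_coeff (q - p) > 0 \<longleftrightarrow> puiseux_value q t - puiseux_value p t > 0"
      by (metis puiseux_value_diff sgn_greater)
    moreover have "puiseux_value q t - puiseux_value p t \<noteq> 0"
      using elim puiseux_lead_coeff_nonzero[OF \<open>q - p \<noteq> 0\<close>] by (metis puiseux_value_diff sgn_zero_iff)
    ultimately show ?case using False by (auto simp: puiseux_le_def)
  qed
qed (simp add: puiseux_le_def)

text \<open>An atom compares two elements whose difference is zero or eventually has the sign of its
  leading coefficient. A formula combines finitely many atoms, so one bound on \<open>t\<close>
  serves them all.\<close>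

lemma eventually_sat_puiseux:
  assumes "quantifier_free \<phi>"
  shows "\<forall>\<^sub>F t in at_top. sat A puiseux_le \<phi> v \<longleftrightarrow> sat UNIV (\<le>) \<phi> (\<lambda>x. puiseux_value (v x) t)"
  using assms
proof (induction \<phi>)
  case (Eq s u)
  from eventually_puiseux_eq[of "trm_value v s" "trm_value v u"] eventually_gt_at_top[of 0]
  show ?case by eventually_elim (simp add: puiseux_value_trm_value)
next
  case (Le s u)
  from eventually_puiseux_le[of "trm_value v s" "trm_value v u"] eventually_gt_at_top[of 0]
  show ?case by eventually_elim (simp add: puiseux_value_trm_value)
next
  case (Neg \<phi>)
  then have "\<forall>\<^sub>F t in at_top. sat A puiseux_le \<phi> v \<longleftrightarrow> sat UNIV (\<le>) \<phi> (\<lambda>x. puiseux_value (v x) t)" by simp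
  then show ?case by eventually_elim simp
next
  case (And \<phi> \<psi>)
  then have "\<forall>\<^sub>F t in at_top. sat A puiseux_le \<phi> v \<longleftrightarrow> sat UNIV (\<le>) \<phi> (\<lambda>x. puiseux_value (v x) t)"
    "\<forall>\<^sub>F t in at_top. sat A puiseux_le \<psi> v \<longleftrightarrow> sat UNIV (\<le>) \<psi> (\<lambda>x. puiseux_value (v x) t)" by simp_all
  then show ?case by eventually_elim simp
next
  case (Or \<phi> \<psi>)
  then have "\<forall>\<^sub>F t in at_top. sat A puiseux_le \<phi> v \<longleftrightarrow> sat UNIV (\<le>) \<phi> (\<lambda>x. puiseux_value (v x) t)"
    "\<forall>\<^sub>F t in at_top. sat A puiseux_le \<psi> v \<longleftrightarrow> sat UNIV (\<le>) \<psi> (\<lambda>x. puiseux_value (v x) t)" by simp_all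
  then show ?case by eventually_elim simp
qed simp_all


section \<open>Diophantine correctness\<close>

lemma sat_of_int:
  assumes "quantifier_free \<phi>"
  shows "sat UNIV (\<le>) \<phi> (\<lambda>x. real_of_int (v x)) \<longleftrightarrow> sat UNIV (\<le>) \<phi> v"
proof -
  have "trm_value (\<lambda>x. real_of_int (v x)) s = of_int (trm_value v s)" for s
    by (induction s) simp_all
  with assms show ?thesis by (induction \<phi>) simp_all
qed

lemma finite_free_vars: "finite (free_vars \<phi>)"
proof -
  have "finite (set_trm s)" for s :: "'a trm" by (induction s) auto
  then show ?thesis by (induction \<phi>) auto
qed

lemma true_in_Forall:
  fixes A :: "'a::comm_ring_1 set" and x :: 'v
  shows "true_in A le (Forall x \<phi>) \<longleftrightarrow> true_in A le \<phi>"
proof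
  assume *: "true_in A le (Forall x \<phi>)"
  show "true_in A le \<phi>" unfolding true_in_def
  proof (intro allI impI)
    fix v :: "'v \<Rightarrow> 'a" assume v: "range v \<subseteq> A"
    then have "\<forall>a\<in>A. sat A le \<phi> (v(x := a))" using * by (auto simp: true_in_def)
    then show "sat A le \<phi> v" using v by (metis fun_upd_triv range_subsetD)
  qed
next
  assume *: "true_in A le \<phi>"
  show "true_in A le (Forall x \<phi>)" unfolding true_in_def
  proof (intro allI impI)
    fix v :: "'v \<Rightarrow> 'a" assume "range v \<subseteq> A"
    then have "range (v(x := a)) \<subseteq> A" if "a \<in> A" for a using that by auto
    then show "sat A le (Forall x \<phi>) v" using * by (auto simp: true_in_def)
  qed
qed

text \<open>\<open>true_in\<close> quantifies over all valuations, so a universal prefix can be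
  stripped; conversely an open formula becomes a sentence by prefixing its free variables.\<close>

lemma diophantine_correct_iff:
  fixes A :: "'a::comm_ring_1 set"
  shows "diophantine_correct A le \<longleftrightarrow>
    (\<forall>\<psi> :: nat fm. quantifier_free \<psi> \<longrightarrow> true_in UNIV ((\<le>) :: int \<Rightarrow> int \<Rightarrow> bool) \<psi> \<longrightarrow> true_in A le \<psi>)"
proof
  assume dc: "diophantine_correct A le"
  show "\<forall>\<psi> :: nat fm. quantifier_free \<psi> \<longrightarrow> true_in UNIV ((\<le>) :: int \<Rightarrow> int \<Rightarrow> bool) \<psi> \<longrightarrow> true_in A le \<psi>"
  proof (intro allI impI)
    fix \<psi> :: "nat fm"
    assume \<psi>: "quantifier_free \<psi>" "true_in UNIV ((\<le>) :: int \<Rightarrow> int \<Rightarrow> bool) \<psi>"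
    obtain xs where xs: "set xs = free_vars \<psi>" using finite_list[OF finite_free_vars[of \<psi>]] by blast
    have vars: "free_vars (foldr Forall ys \<psi>) = free_vars \<psi> - set ys" for ys
      by (induction ys) auto
    have "universal (foldr Forall ys \<psi>)" for ys
      by (induction ys) (simp_all add: \<psi>(1) universal.intros)
    then have sentence: "universal_sentence (foldr Forall xs \<psi>)"
      by (simp add: universal_sentence_def vars xs)
    have int: "true_in UNIV ((\<le>) :: int \<Rightarrow> int \<Rightarrow> bool) (foldr Forall ys \<psi>)" for ys
      by (induction ys) (simp_all add: \<psi>(2) true_in_Forall)
    have "true_in A le (foldr Forall ys \<psi>) \<longleftrightarrow> true_in A le \<psi>" for ys
      by (induction ys) (simp_all add: true_in_Forall)
    then show "true_in A le \<psi>" using dc sentence int unfolding diophantine_correct_def by blast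
  qed
next
  assume qf: "\<forall>\<psi> :: nat fm. quantifier_free \<psi> \<longrightarrow> true_in UNIV ((\<le>) :: int \<Rightarrow> int \<Rightarrow> bool) \<psi> \<longrightarrow> true_in A le \<psi>"
  have "true_in UNIV ((\<le>) :: int \<Rightarrow> int \<Rightarrow> bool) \<phi> \<Longrightarrow> true_in A le \<phi>" if "universal \<phi>" for \<phi> :: "nat fm"
    using that
  proof induction
    case (1 \<phi>)
    then show ?case using qf by blast
  next
    case (2 \<phi> x)
    then show ?case unfolding true_in_Forall by blast
  qed
  then show "diophantine_correct A le" by (simp add: diophantine_correct_def universal_sentence_def)
qed

text \<open>Thereby a valuation in the generated ring is a substitution of terms, and a formula
  about the ring becomes one evaluated at the generators.\<close>

lemma subring_hull_range: "subring hull (range f) = range (trm_value f)"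
proof (rule hull_unique)
  show "range f \<subseteq> range (trm_value f)"
    by (metis image_subsetI rangeI trm_value.simps(1))
  show "subring (range (trm_value f))"
    unfolding subring_def
  proof (intro conjI ballI)
    show "0 \<in> range (trm_value f)" by (rule range_eqI[of _ _ Zero]) simp
    show "1 \<in> range (trm_value f)" by (rule range_eqI[of _ _ One]) simp
    fix a b assume "a \<in> range (trm_value f)" "b \<in> range (trm_value f)"
    then obtain s t where st: "a = trm_value f s" "b = trm_value f t" by blast
    show "a + b \<in> range (trm_value f)" by (rule range_eqI[of _ _ "Add s t"]) (simp add: st)
    show "a - b \<in> range (trm_value f)" by (rule range_eqI[of _ _ "Sub s t"]) (simp add: st)
    show "a * b \<in> range (trm_value f)" by (rule range_eqI[of _ _ "Mul s t"]) (simp add: st)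
  qed
next
  fix T assume T: "range f \<subseteq> T" "subring T"
  have "trm_value f s \<in> T" for s
    using T by (induction s) (auto simp: subring_def)
  then show "range (trm_value f) \<subseteq> T" by blast
qed


section \<open>Generic points\<close>

text \<open>Links the terms in formulas to the rational polynomials in the definition of algebraic
  independence. One \<open>p\<close> serves all points, so that a term vanishing at an independent
  point vanishes everywhere.\<close>

lemma mpoly_value_trm_value:
  "\<exists>p. \<forall>r. mpoly_value p r = trm_value r s"
proof -
  have me: "monomial_evaluation of_rat (\<lambda>m. \<Prod>j\<in>UNIV. r j ^ Poly_Mapping.lookup m j)" for r :: "'a \<Rightarrow> real"
    by unfold_locales (simp_all add: of_rat_add of_rat_mult lookup_add power_add prod.distrib)
  note eval = monomial_evaluation.eval_def[OF me, folded mpoly_value_def]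
  note hom = monomial_evaluation.eval_0[OF me, unfolded eval] monomial_evaluation.eval_add[OF me, unfolded eval]
    monomial_evaluation.eval_diff[OF me, unfolded eval] monomial_evaluation.eval_mult[OF me, unfolded eval]
    monomial_evaluation.eval_single[OF me, unfolded eval]
  show ?thesis
  proof (induction s)
    case (Var j)
    have "(\<Prod>i\<in>UNIV. r i ^ Poly_Mapping.lookup (Poly_Mapping.single j 1) i) = r j" for r :: "'a \<Rightarrow> real"
    proof -
      have "(\<Prod>i\<in>UNIV. r i ^ Poly_Mapping.lookup (Poly_Mapping.single j 1) i) = (\<Prod>i\<in>UNIV. if i = j then r j else 1)"
        by (intro prod.cong) (auto simp: lookup_single)
      then show ?thesis by simp
    qed
    then show ?case by (intro exI[of _ "Poly_Mapping.single (Poly_Mapping.single j 1) 1"]) (simp add: hom)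
  next
    case Zero
    show ?case by (intro exI[of _ 0]) (simp add: hom)
  next
    case One
    show ?case by (intro exI[of _ "Poly_Mapping.single 0 1"]) (simp add: hom del: single_one)
  next
    case (Add s t)
    then show ?case by (metis hom(2) trm_value.simps(4))
  next
    case (Sub s t)
    then show ?case by (metis hom(3) trm_value.simps(5))
  next
    case (Mul s t)
    then show ?case by (metis hom(4) trm_value.simps(6))
  qed
qed

text \<open>A term that vanishes at \<open>r\<close> vanishes identically by independence; any other
  keeps its sign near \<open>r\<close> by continuity.\<close>

lemma eventually_sat_generic:
  fixes r :: "real^'l::finite"
  assumes "algebraically_independent (\<lambda>j. r $ j)" "quantifier_free \<phi>"
  shows "\<forall>\<^sub>F x in nhds r. sat UNIV (\<le>) \<phi> (\<lambda>j. x $ j) \<longleftrightarrow> sat UNIV (\<le>) \<phi> (\<lambda>j. r $ j)"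
proof -
  have "\<forall>\<^sub>F x in nhds r. sgn (trm_value (\<lambda>j. x $ j) s) = sgn (trm_value (\<lambda>j. r $ j) s)" for s
  proof (cases "trm_value (\<lambda>j. r $ j) s = 0")
    case True
    obtain p where p: "\<And>r. mpoly_value p r = trm_value r s" using mpoly_value_trm_value[of s] by blast
    then have "p = 0" using assms(1) True unfolding algebraically_independent_def by metis
    then have "trm_value x s = 0" for x :: "'l \<Rightarrow> real" using p[of x] by (simp add: mpoly_value_def)
    then show ?thesis by simp
  next
    case False
    let ?g = "\<lambda>x::real^'l. trm_value (\<lambda>j. x $ j) s"
    have "(?g \<longlongrightarrow> ?g r) (nhds r)"
      by (induction s) (auto intro!: tendsto_intros filterlim_ident)
    then have lim: "\<And>a. ?g r < a \<Longrightarrow> \<forall>\<^sub>F x in nhds r. ?g x < a" "\<And>a. a < ?g r \<Longrightarrow> \<forall>\<^sub>F x in nhds r. a < ?g x"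
      by (auto dest: order_tendstoD)
    show ?thesis
    proof (cases "?g r > 0")
      case True
      from lim(2)[OF this] show ?thesis by eventually_elim (use True in simp)
    next
      case *: False
      then have "?g r < 0" using False by simp
      from lim(1)[OF this] show ?thesis by eventually_elim (use \<open>?g r < 0\<close> in simp)
    qed
  qed
  then have "\<forall>\<^sub>F x in nhds r. \<forall>s\<in>atom_diffs \<phi>. sgn (trm_value (\<lambda>j. x $ j) s) = sgn (trm_value (\<lambda>j. r $ j) s)"
    using finite_atom_diffs by (intro eventually_ball_finite) auto
  then show ?thesis by eventually_elim (use sat_cong_sgn[OF assms(2)] in blast)
qed


section \<open>Definability of the curve\<close>

text \<open>Terms have integer coefficients, so the denominator of \<open>q\<close> is multiplied
  out.\<close>

lemma semialgebraic_less_rat: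
  assumes "q \<in> \<rat>" "polynomial_fun g"
  shows "semialgebraic (\<lambda>v. q < g v)" "semialgebraic (\<lambda>v. g v < q)"
proof -
  obtain a b where ab: "b > 0" "q = of_int a / of_int b"
    using assms(1) by (auto elim: Rats_cases')
  then have "q < x \<longleftrightarrow> of_int a < of_int b * x" "x < q \<longleftrightarrow> of_int b * x < of_int a" for x
    by (simp_all add: pos_divide_less_eq pos_less_divide_eq mult.commute)
  then show "semialgebraic (\<lambda>v. q < g v)" "semialgebraic (\<lambda>v. g v < q)"
    by (simp_all add: semialgebraic_less polynomial_fun_mult polynomial_fun_of_int assms)
qed

text \<open>Fractions of integer polynomials at \<open>r\<close> already form a subfield.\<close>

lemma subfield_hull_fraction:
  assumes "c \<in> subfield hull (range r)"
  shows "\<exists>P Q. polynomial_fun P \<and> polynomial_fun Q \<and> Q r \<noteq> 0 \<and> c = P r / Q r"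
proof -
  let ?K = "{P r / Q r | P Q. polynomial_fun P \<and> polynomial_fun Q \<and> Q r \<noteq> 0}"
  have fraction: "P r / Q r \<in> ?K" if "polynomial_fun P" "polynomial_fun Q" "Q r \<noteq> 0" for P Q
    using that by blast
  have "range r \<subseteq> ?K"
    using fraction[OF polynomial_fun_var polynomial_fun_1] by auto
  moreover have "subfield ?K"
    unfolding subfield_def subring_def
  proof (intro conjI ballI)
    show "0 \<in> ?K" using fraction[OF polynomial_fun_0 polynomial_fun_1] by simp
    show "1 \<in> ?K" using fraction[OF polynomial_fun_1 polynomial_fun_1] by simp
  next
    fix a b assume "a \<in> ?K" "b \<in> ?K"
    then obtain P Q P' Q' where *: "polynomial_fun P" "polynomial_fun Q" "Q r \<noteq> 0" "a = P r / Q r"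
      "polynomial_fun P'" "polynomial_fun Q'" "Q' r \<noteq> 0" "b = P' r / Q' r" by blast
    show "a + b \<in> ?K"
      using fraction[of "\<lambda>v. P v * Q' v + P' v * Q v" "\<lambda>v. Q v * Q' v"] *
      by (simp add: polynomial_fun_intros add_frac_eq)
    show "a - b \<in> ?K"
      using fraction[of "\<lambda>v. P v * Q' v - P' v * Q v" "\<lambda>v. Q v * Q' v"] *
      by (simp add: polynomial_fun_intros diff_frac_eq)
    show "a * b \<in> ?K"
      using fraction[of "\<lambda>v. P v * P' v" "\<lambda>v. Q v * Q' v"] * by (simp add: polynomial_fun_intros)
  next
    fix a assume "a \<in> ?K"
    then obtain P Q where *: "polynomial_fun P" "polynomial_fun Q" "Q r \<noteq> 0" "a = P r / Q r" by blast
    show "inverse a \<in> ?K"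
    proof (cases "P r = 0")
      case True
      then show ?thesis using * fraction[OF polynomial_fun_0 polynomial_fun_1] by simp
    next
      case False
      then show ?thesis using * fraction[of Q P] by simp
    qed
  qed
  ultimately have "c \<in> ?K" using assms hull_minimal[of "range r" ?K subfield] by blast
  then show ?thesis by blast
qed

lemma polynomial_fun_rename:
  assumes "polynomial_fun P"
  shows "polynomial_fun (\<lambda>v. P (\<lambda>x. v (\<sigma> x)))"
proof -
  obtain s where s: "\<And>v. P v = trm_value v s" using assms by (auto simp: polynomial_fun_def)
  have "P (\<lambda>x. v (\<sigma> x)) = trm_value v (subst_trm (\<lambda>x. Var (\<sigma> x)) s)" for v
    by (simp add: s trm_value_subst_trm)
  then show ?thesis unfolding polynomial_fun_def by blast
qed

text \<open>In \<open>T\<close> the variable \<open>None\<close> stands for the argument of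
  \<open>p\<close> and \<open>Some j\<close> for \<open>r j\<close>. The factor \<open>E r\<close>
  is a product of denominators of the coefficients, built up along Horner's scheme.\<close>

lemma poly_clear_denominators:
  fixes r :: "'l \<Rightarrow> real"
  assumes "\<And>k. coeff p k \<in> subfield hull (range r)"
  shows "\<exists>T E. polynomial_fun T \<and> polynomial_fun E \<and> E r \<noteq> 0 \<and>
    (\<forall>x. T (case_option x r) = E r * poly p x)"
  using assms
proof (induction p)
  case 0
  show ?case using polynomial_fun_0 polynomial_fun_1
    by (intro exI[of _ "\<lambda>v. 0"] exI[of _ "\<lambda>v. 1"]) auto
next
  case (pCons c p)
  have "coeff p k \<in> subfield hull (range r)" for k using pCons.prems[of "Suc k"] by simp
  then obtain T E where TE: "polynomial_fun T" "polynomial_fun E" "E r \<noteq> 0"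
    "\<And>x. T (case_option x r) = E r * poly p x" using pCons.IH by blast
  obtain P Q where PQ: "polynomial_fun P" "polynomial_fun Q" "Q r \<noteq> 0" "c = P r / Q r"
    using subfield_hull_fraction[of c r] pCons.prems[of 0] by auto
  let ?T = "\<lambda>v. P (\<lambda>j. v (Some j)) * E (\<lambda>j. v (Some j)) + v None * (Q (\<lambda>j. v (Some j)) * T v)"
  have "polynomial_fun ?T"
    by (intro polynomial_fun_add polynomial_fun_mult polynomial_fun_var TE(1)
        polynomial_fun_rename[OF PQ(1)] polynomial_fun_rename[OF PQ(2)] polynomial_fun_rename[OF TE(2)])
  moreover have "?T (case_option x r) = (Q r * E r) * poly (pCons c p) x" for x
    using TE(3) PQ(3) by (simp add: TE(4) PQ(4) field_simps)
  ultimately show ?case using polynomial_fun_mult[OF PQ(2) TE(2)] TE(3) PQ(3)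
    by (intro exI[of _ ?T] exI[of _ "\<lambda>v. Q v * E v"]) auto
qed

text \<open>The semialgebraic condition singles out \<open>a\<close> among the roots of its algebraic equation by an
  interval with rational end points.\<close>

lemma algebraic_definable:
  fixes r :: "'l \<Rightarrow> real"
  assumes "algebraic_over (subfield hull (range r)) a"
  shows "\<exists>P. semialgebraic P \<and> (\<forall>x. P (case_option x r) \<longleftrightarrow> x = a)"
proof -
  obtain p where p: "p \<noteq> 0" "\<And>k. coeff p k \<in> subfield hull (range r)" "poly p a = 0"
    using assms by (auto simp: algebraic_over_def)
  obtain T E where T: "polynomial_fun T" "E r \<noteq> 0" "\<And>x. T (case_option x r) = E r * poly p x"
    using poly_clear_denominators[of p r] p(2) by blast
  have "finite ({x. poly p x = 0} - {a})" using p(1) by (simp add: poly_roots_finite)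
  moreover have "z < a \<or> a < z" if "z \<in> {x. poly p x = 0} - {a}" for z using that by auto
  ultimately obtain lo hi where lohi: "lo < a" "a < hi" "\<forall>z\<in>{x. poly p x = 0} - {a}. z < lo \<or> hi < z"
    using finite_avoid_interval by blast
  obtain q1 q2 where q: "q1 \<in> \<rat>" "lo < q1" "q1 < a" "q2 \<in> \<rat>" "a < q2" "q2 < hi"
    using Rats_dense_in_real lohi by metis
  let ?P = "\<lambda>v. T v = 0 \<and> q1 < v None \<and> v None < q2"
  have "semialgebraic ?P"
    by (intro semialgebraic_conj semialgebraic_eq semialgebraic_less_rat T polynomial_fun_intros q)
  moreover have "?P (case_option x r) \<longleftrightarrow> x = a" for x
  proof
    assume "?P (case_option x r)"
    then have "poly p x = 0" "lo < x" "x < hi" using T(2,3) q by auto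
    then show "x = a" using lohi(3) by (metis (mono_tags) Diff_iff mem_Collect_eq not_less_iff_gr_or_eq singletonD)
  qed (use T(3) p(3) q in simp)
  ultimately show ?thesis by blast
qed

lemma common_denominator:
  assumes "finite (Q :: rat set)"
  shows "\<exists>D>0::nat. \<forall>q\<in>Q. \<exists>k::int. q * of_nat D = of_int k"
  using assms
proof (induction Q)
  case empty
  show ?case by (intro exI[of _ 1]) simp
next
  case (insert p Q)
  then obtain D where D: "D > 0" "\<forall>q\<in>Q. \<exists>k::int. q * of_nat D = of_int k" by auto
  obtain a b where ab: "b > 0" "p = of_int a / of_int b" by (metis quotient_of_div quotient_of_denom_pos surj_pair)
  have "p * of_nat (D * nat b) = of_int (a * int D)" using ab by (simp add: field_simps)
  moreover have "\<exists>k::int. q * of_nat (D * nat b) = of_int k" if q: "q \<in> Q" for q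
  proof -
    obtain k where "q * of_nat D = of_int k" using D q by blast
    then have "q * of_nat (D * nat b) = of_int (k * b)" using ab(1) by (simp add: mult.assoc[symmetric])
    then show ?thesis by blast
  qed
  ultimately have "\<forall>q\<in>insert p Q. \<exists>k::int. q * of_nat (D * nat b) = of_int k" by blast
  moreover have "D * nat b > 0" using D(1) ab(1) by simp
  ultimately show ?case by blast
qed

text \<open>With \<open>t\<close> written as a power of \<tau>, the curve is given by existential
  quantifiers over \<tau> and over the coefficients, each coefficient pinned down by a condition on
  \<open>r\<close>. These quantifiers are then eliminated.\<close>

lemma curve_definable:
  fixes f :: "'n::finite \<Rightarrow> gen_puiseux" and r :: "real^'l::finite"
  assumes pos: "\<And>i. f i \<in> puiseux_polynomials"
    and r: "transcendence_basis r (subfield hull (\<Union>i. puiseux_coeffs (f i)))"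
  shows "\<exists>\<theta>. defines_curve \<theta> r f"
proof -
  let ?X = "SIGMA i:UNIV. Poly_Mapping.keys (f i)"
  have "finite (\<Union>i. Poly_Mapping.keys (f i))" by simp
  from common_denominator[OF this] obtain D :: nat where D: "D > 0"
    "\<forall>q\<in>(\<Union>i. Poly_Mapping.keys (f i)). \<exists>k::int. q * of_nat D = of_int k" by blast
  define e where "e q = nat \<lfloor>q * rat_of_nat D\<rfloor>" for q
  have e: "q * of_nat D = of_nat (e q)" if q: "q \<in> Poly_Mapping.keys (f i)" for i q
  proof -
    obtain k :: int where k: "q * of_nat D = of_int k" using D(2) q by blast
    have "0 \<le> q" using pos[of i] q by (auto simp: puiseux_polynomials_def)
    then have "0 \<le> (of_int k :: rat)" using k by (metis mult_nonneg_nonneg of_nat_0_le_iff)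
    then show ?thesis by (simp add: e_def k)
  qed
  define is_coeff where "is_coeff i q = (\<lambda>P. semialgebraic P \<and>
    (\<forall>x. P (case_option x (\<lambda>j. r $ j)) \<longleftrightarrow> x = Poly_Mapping.lookup (f i) q))" for i q
  define P where "P i q = (SOME P. is_coeff i q P)" for i q
  have "\<exists>P. is_coeff i q P" if "q \<in> Poly_Mapping.keys (f i)" for i q
    unfolding is_coeff_def
  proof (rule algebraic_definable)
    have "Poly_Mapping.lookup (f i) q \<in> subfield hull (\<Union>i. puiseux_coeffs (f i))"
      using that by (intro hull_inc) (auto simp: puiseux_coeffs_def)
    then show "algebraic_over (subfield hull range (\<lambda>j. r $ j)) (Poly_Mapping.lookup (f i) q)"
      using r by (simp add: transcendence_basis_def)
  qed
  then have "is_coeff i q (P i q)" if "q \<in> Poly_Mapping.keys (f i)" for i q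
    using someI_ex that unfolding P_def by metis
  then have P: "semialgebraic (P i q)"
    "P i q (case_option x (\<lambda>j. r $ j)) \<longleftrightarrow> x = Poly_Mapping.lookup (f i) q"
    if "q \<in> Poly_Mapping.keys (f i)" for i q x
    using that unfolding is_coeff_def by blast+
  \<comment> \<open>\<open>Inl\<close> carries the variables of \<theta>. Among the auxiliary ones,
    \<open>Inr None\<close> is \<tau> and \<open>Inr (Some (i, q))\<close> is the coefficient of
    \<open>f i\<close> at exponent \<open>q\<close>.\<close>
  define S :: "(('l + 'n) + ('n \<times> rat) option \<Rightarrow> real) \<Rightarrow> bool" where "S v \<longleftrightarrow> 1 \<le> v (Inr None) \<and>
      (\<forall>a\<in>?X. P (fst a) (snd a) (\<lambda>j. v (case j of None \<Rightarrow> Inr (Some a) | Some j \<Rightarrow> Inl (Inl j)))) \<and>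
      (\<forall>i\<in>UNIV. v (Inl (Inr i)) = (\<Sum>q\<in>Poly_Mapping.keys (f i). v (Inr (Some (i, q))) * v (Inr None) ^ e q))" for v
  have finX: "finite ?X" by simp
  have "semialgebraic S"
    unfolding S_def
    by (intro semialgebraic_conj semialgebraic_le semialgebraic_finite_ball semialgebraic_eq polynomial_fun_intros
        semialgebraic_subst[OF P(1)] finX finite_class.finite_UNIV) auto
  then have "semialgebraic (\<lambda>v. \<exists>u. (\<forall>x. x \<notin> Inr ` insert None (Some ` ?X) \<longrightarrow> u x = v x) \<and> S u)"
    using finX by (intro semialgebraic_exists_finite) simp_all
  \<comment> \<open>Auxiliary variables start with the default 0; the quantified ones are
    overwritten by \<open>u\<close>.\<close>
  moreover have "polynomial_fun (\<lambda>w. case_sum w (\<lambda>_. 0) x)" for x :: "('l + 'n) + ('n \<times> rat) option"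
    by (cases x) (simp_all add: polynomial_fun_intros)
  ultimately have "semialgebraic (\<lambda>w. \<exists>u. (\<forall>x. x \<notin> Inr ` insert None (Some ` ?X) \<longrightarrow>
      u x = case_sum w (\<lambda>_. 0) x) \<and> S u)"
    by (rule semialgebraic_subst)
  then obtain \<theta> where \<theta>: "quantifier_free \<theta>" "\<And>w. sat UNIV (\<le>) \<theta> w \<longleftrightarrow>
      (\<exists>u. (\<forall>x. x \<notin> Inr ` insert None (Some ` ?X) \<longrightarrow> u x = case_sum w (\<lambda>_. 0) x) \<and> S u)"
    unfolding semialgebraic_def by auto
  have power: "(\<tau> ^ D) powr of_rat q = \<tau> ^ e q" if "1 \<le> \<tau>" "q \<in> Poly_Mapping.keys (f i)" for \<tau> :: real and i q
  proof -
    have "real D * of_rat q = real (e q)" using e[OF that(2)]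
      by (metis mult.commute of_rat_mult of_rat_of_nat_eq)
    moreover have "(\<tau> ^ D) powr of_rat q = \<tau> powr (real D * of_rat q)"
      using that(1) by (simp add: powr_realpow[symmetric] powr_powr)
    ultimately show ?thesis using that(1) by (simp add: powr_realpow)
  qed
  have "real_models \<theta> r y \<longleftrightarrow> (\<exists>t\<ge>1. \<forall>i. y $ i = puiseux_value (f i) t)" for y
  proof
    assume "real_models \<theta> r y"
    then obtain u where u: "\<And>x. x \<notin> Inr ` insert None (Some ` ?X) \<Longrightarrow>
        u x = case_sum (case_sum (\<lambda>j. r $ j) (\<lambda>i. y $ i)) (\<lambda>_. 0) x" and "S u"
      unfolding real_models_def \<theta>(2) by blast
    have ul: "u (Inl (Inl j)) = r $ j" "u (Inl (Inr i)) = y $ i" for i j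
      using u[of "Inl (Inl j)"] u[of "Inl (Inr i)"] by auto
    have coeffs: "u (Inr (Some (i, q))) = Poly_Mapping.lookup (f i) q" if "q \<in> Poly_Mapping.keys (f i)" for i q
    proof -
      have "(\<lambda>j. u (case j of None \<Rightarrow> Inr (Some (i, q)) | Some j \<Rightarrow> Inl (Inl j))) =
          case_option (u (Inr (Some (i, q)))) (\<lambda>j. r $ j)"
        by (auto simp: fun_eq_iff ul split: option.split)
      moreover have "P i q (\<lambda>j. u (case j of None \<Rightarrow> Inr (Some (i, q)) | Some j \<Rightarrow> Inl (Inl j)))"
        using \<open>S u\<close> that unfolding S_def by force
      ultimately show ?thesis using P(2)[OF that] by simp
    qed
    let ?\<tau> = "u (Inr None)"
    have \<tau>: "1 \<le> ?\<tau>" using \<open>S u\<close> by (simp add: S_def)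
    have "y $ i = puiseux_value (f i) (?\<tau> ^ D)" for i
    proof -
      have "y $ i = (\<Sum>q\<in>Poly_Mapping.keys (f i). u (Inr (Some (i, q))) * ?\<tau> ^ e q)"
        using \<open>S u\<close> unfolding S_def ul by blast
      also have "\<dots> = puiseux_value (f i) (?\<tau> ^ D)"
        unfolding puiseux_value_def by (intro sum.cong refl) (simp add: coeffs power \<tau>)
      finally show ?thesis .
    qed
    moreover have "1 \<le> ?\<tau> ^ D" using \<tau> by simp
    ultimately show "\<exists>t\<ge>1. \<forall>i. y $ i = puiseux_value (f i) t" by blast
  next
    assume "\<exists>t\<ge>1. \<forall>i. y $ i = puiseux_value (f i) t"
    then obtain t where t: "t \<ge> 1" "\<And>i. y $ i = puiseux_value (f i) t" by blast
    define \<tau> where "\<tau> = t powr (1 / real D)"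
    have \<tau>: "1 \<le> \<tau>" using t(1) by (simp add: \<tau>_def ge_one_powr_ge_zero)
    have "\<tau> ^ D = t" using t(1) D(1) by (simp add: \<tau>_def powr_realpow[symmetric] powr_powr)
    \<comment> \<open>At exponents that do not occur the lookup is 0, in agreement with the default
      of the unquantified variables.\<close>
    define u where "u = case_sum (case_sum (\<lambda>j. r $ j) (\<lambda>i. y $ i))
      (case_option \<tau> (\<lambda>a. Poly_Mapping.lookup (f (fst a)) (snd a)))"
    have "S u" unfolding S_def
    proof (intro conjI ballI)
      show "1 \<le> u (Inr None)" using \<tau> by (simp add: u_def)
    next
      fix a assume a: "a \<in> ?X"
      have "(\<lambda>j. u (case j of None \<Rightarrow> Inr (Some a) | Some j \<Rightarrow> Inl (Inl j))) =
          case_option (Poly_Mapping.lookup (f (fst a)) (snd a)) (\<lambda>j. r $ j)"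
        by (auto simp: fun_eq_iff u_def split: option.split)
      then show "P (fst a) (snd a) (\<lambda>j. u (case j of None \<Rightarrow> Inr (Some a) | Some j \<Rightarrow> Inl (Inl j)))"
        using P(2)[of "snd a" "fst a"] a by auto
    next
      fix i
      have "puiseux_value (f i) (\<tau> ^ D) = (\<Sum>q\<in>Poly_Mapping.keys (f i). Poly_Mapping.lookup (f i) q * \<tau> ^ e q)"
        unfolding puiseux_value_def by (intro sum.cong refl) (simp add: power \<tau>)
      then show "u (Inl (Inr i)) = (\<Sum>q\<in>Poly_Mapping.keys (f i). u (Inr (Some (i, q))) * u (Inr None) ^ e q)"
        by (simp add: u_def t(2) \<open>\<tau> ^ D = t\<close>)
    qed
    moreover have "u x = case_sum (case_sum (\<lambda>j. r $ j) (\<lambda>i. y $ i)) (\<lambda>_. 0) x"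
      if outside: "x \<notin> Inr ` insert None (Some ` ?X)" for x
    proof (cases x)
      case (Inl z)
      then show ?thesis by (simp add: u_def)
    next
      case (Inr o')
      then have "o' \<noteq> None" using outside by auto
      then obtain i q where o': "o' = Some (i, q)" by auto
      then have "q \<notin> Poly_Mapping.keys (f i)" using outside Inr by blast
      then show ?thesis using Inr o' by (simp add: u_def in_keys_iff)
    qed
    ultimately show "real_models \<theta> r y" unfolding real_models_def \<theta>(2) by blast
  qed
  then show ?thesis using \<theta>(1) unfolding defines_curve_def by blast
qed


section \<open>Integer points near the curve\<close>

text \<open>A counterexample to \<psi> in the ring spreads to all far points of the curve, then to
  far solutions of \<theta> for parameters near \<open>r\<close>, and so to an integer
  point.\<close>

lemma diophantine_correct_if_integer_points:
  fixes f :: "'n::finite \<Rightarrow> gen_puiseux" and r :: "real^'l::finite"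
  assumes pos: "\<And>i. f i \<in> puiseux_polynomials"
    and indep: "algebraically_independent (\<lambda>j. r $ j)"
    and \<theta>: "defines_curve \<theta> r f"
    and points: "\<And>U M. open U \<Longrightarrow> r \<in> U \<Longrightarrow> 0 < M \<Longrightarrow>
      \<exists>s\<in>U. \<exists>m :: int^'n. (\<forall>i. M < \<bar>m $ i\<bar>) \<and> real_models \<theta> s (\<chi> i. of_int (m $ i))"
  shows "diophantine_correct (subring hull (range f)) puiseux_le"
  unfolding diophantine_correct_iff
proof (intro allI impI, rule ccontr)
  fix \<psi> :: "nat fm"
  let ?A = "subring hull (range f)"
  assume \<psi>: "quantifier_free \<psi>" "true_in UNIV ((\<le>) :: int \<Rightarrow> int \<Rightarrow> bool) \<psi>"
    and "\<not> true_in ?A puiseux_le \<psi>"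
  then obtain v where v: "range v \<subseteq> ?A" "\<not> sat ?A puiseux_le \<psi> v" by (auto simp: true_in_def)
  then have "\<forall>x. \<exists>s. v x = trm_value f s" unfolding subring_hull_range by blast
  then obtain g where g: "\<And>x. v x = trm_value f (g x)" by metis
  \<comment> \<open>The values of the counterexample \<open>v\<close> are terms in \<open>f\<close>;
    after substituting them, \<phi> holds at \<open>f\<close> itself.\<close>
  define \<phi> where "\<phi> = Neg (subst_fm g \<psi>)"
  have \<phi>: "quantifier_free \<phi>" by (simp add: \<phi>_def subst_fm \<psi>(1))
  have "v = (\<lambda>x. trm_value f (g x))" using g by blast
  then have "sat ?A puiseux_le \<phi> f" using v(2) by (simp add: \<phi>_def subst_fm \<psi>(1))
  then have "\<forall>\<^sub>F t in at_top. sat UNIV (\<le>) \<phi> (\<lambda>i. puiseux_value (f i) t)"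
    using eventually_sat_puiseux[OF \<phi>, of ?A f] by simp
  then obtain N where N: "\<And>t. N \<le> t \<Longrightarrow> sat UNIV (\<le>) \<phi> (\<lambda>i. puiseux_value (f i) t)"
    unfolding eventually_at_top_linorder by blast
  \<comment> \<open>One coordinate, at the arbitrary index \<open>undefined\<close>, suffices to
    force \<open>t\<close> up to \<open>N\<close>.\<close>
  obtain B where B: "\<And>t. 1 \<le> t \<Longrightarrow> t \<le> N \<Longrightarrow> \<bar>puiseux_value (f undefined) t\<bar> \<le> B"
    using puiseux_value_bounded[OF pos] by blast
  define M where "M = max 1 \<lceil>B\<rceil>"
  \<comment> \<open>The language has no absolute value, hence the disjunction.\<close>
  let ?big = "\<lambda>u :: 'l + 'n \<Rightarrow> real. \<forall>i\<in>UNIV. of_int M < u (Inr i) \<or> u (Inr i) < - of_int M"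
  have big: "(of_int M < x \<or> x < - of_int M) \<longleftrightarrow> of_int M < \<bar>x\<bar>" for x :: real by auto
  have "semialgebraic (\<lambda>u. sat UNIV (\<le>) \<theta> u \<and> ?big u \<and> \<not> sat UNIV (\<le>) \<phi> (\<lambda>i. u (Inr i)))"
    using \<theta> unfolding defines_curve_def
    by (intro semialgebraic_conj semialgebraic_finite_ball semialgebraic_disj semialgebraic_less semialgebraic_not
        semialgebraic_sat semialgebraic_subst[OF semialgebraic_sat[OF \<phi>]] polynomial_fun_intros) auto
  then have "semialgebraic (\<lambda>v. \<not> (\<exists>u. (\<forall>x. x \<notin> range Inr \<longrightarrow> u x = v x) \<and>
      sat UNIV (\<le>) \<theta> u \<and> ?big u \<and> \<not> sat UNIV (\<le>) \<phi> (\<lambda>i. u (Inr i))))"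
    by (intro semialgebraic_not semialgebraic_exists_finite) auto
  moreover have "polynomial_fun (\<lambda>w. case_sum w (\<lambda>_. 0) x)" for x :: "'l + 'n"
    by (cases x) (simp_all add: polynomial_fun_intros)
  ultimately have "semialgebraic (\<lambda>w. \<not> (\<exists>u. (\<forall>x. x \<notin> range Inr \<longrightarrow> u x = case_sum w (\<lambda>_. 0) x) \<and>
      sat UNIV (\<le>) \<theta> u \<and> ?big u \<and> \<not> sat UNIV (\<le>) \<phi> (\<lambda>i. u (Inr i))))"
    by (rule semialgebraic_subst)
  \<comment> \<open>\<rho> says of a parameter point that every solution of \<theta> with large
    coordinates satisfies \<phi>. It mentions parameters only, so genericity of \<open>r\<close>
    applies to it.\<close>
  then obtain \<rho> where \<rho>: "quantifier_free \<rho>" "\<And>w. sat UNIV (\<le>) \<rho> w \<longleftrightarrow>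
      \<not> (\<exists>u. (\<forall>x. x \<notin> range Inr \<longrightarrow> u x = case_sum w (\<lambda>_. 0) x) \<and>
      sat UNIV (\<le>) \<theta> u \<and> ?big u \<and> \<not> sat UNIV (\<le>) \<phi> (\<lambda>i. u (Inr i)))"
    unfolding semialgebraic_def by auto
  have "sat UNIV (\<le>) \<rho> (\<lambda>j. r $ j)"
    unfolding \<rho>(2)
  proof (intro notI, elim exE conjE)
    fix u :: "'l + 'n \<Rightarrow> real"
    assume u: "\<forall>x. x \<notin> range Inr \<longrightarrow> u x = case_sum (\<lambda>j. r $ j) (\<lambda>_. 0) x"
      "sat UNIV (\<le>) \<theta> u" "?big u" "\<not> sat UNIV (\<le>) \<phi> (\<lambda>i. u (Inr i))"
    have "u = case_sum (\<lambda>j. r $ j) (\<lambda>i. (\<chi> i. u (Inr i)) $ i)"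
    proof
      show "u x = case_sum (\<lambda>j. r $ j) (\<lambda>i. (\<chi> i. u (Inr i)) $ i) x" for x
        using u(1) by (cases x) auto
    qed
    then have "real_models \<theta> r (\<chi> i. u (Inr i))" using u(2) unfolding real_models_def by metis
    then obtain t where t: "t \<ge> 1" "\<And>i. u (Inr i) = puiseux_value (f i) t"
      using \<theta> unfolding defines_curve_def by auto
    have "of_int M < \<bar>puiseux_value (f undefined) t\<bar>" using bspec[OF u(3) UNIV_I] unfolding big t(2) .
    moreover have "B \<le> of_int M" by (simp add: M_def) linarith
    ultimately have "N \<le> t" using B[OF t(1)] by linarith
    then show False using N u(4) t(2) by simp
  qed
  then have "\<forall>\<^sub>F s in nhds r. sat UNIV (\<le>) \<rho> (\<lambda>j. s $ j)"
    using eventually_sat_generic[OF indep \<rho>(1)] by simp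
  then obtain U where U: "open U" "r \<in> U" "\<And>s. s \<in> U \<Longrightarrow> sat UNIV (\<le>) \<rho> (\<lambda>j. s $ j)"
    unfolding eventually_nhds by blast
  have "0 < M" by (simp add: M_def)
  from points[OF U(1,2) this] obtain s and m :: "int^'n" where s: "s \<in> U" "\<And>i. M < \<bar>m $ i\<bar>" "real_models \<theta> s (\<chi> i. of_int (m $ i))"
    by blast
  let ?u = "case_sum (\<lambda>j. s $ j) (\<lambda>i. real_of_int (m $ i)) :: 'l + 'n \<Rightarrow> real"
  have "\<forall>x. x \<notin> range Inr \<longrightarrow> ?u x = case_sum (\<lambda>j. s $ j) (\<lambda>_. 0) x"
    by (auto split: sum.split)
  moreover have "sat UNIV (\<le>) \<theta> ?u" using s(3) by (simp add: real_models_def)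
  moreover have "?big ?u"
  proof
    fix i
    have "real_of_int M < \<bar>real_of_int (m $ i)\<bar>" using s(2)[of i] by linarith
    then show "of_int M < ?u (Inr i) \<or> ?u (Inr i) < - of_int M" unfolding big by simp
  qed
  ultimately have "sat UNIV (\<le>) \<phi> (\<lambda>i. ?u (Inr i))" using U(3)[OF s(1)] unfolding \<rho>(2) by blast
  then have "sat UNIV (\<le>) \<phi> (\<lambda>i. m $ i)" using sat_of_int[OF \<phi>] by simp
  then have "\<not> sat UNIV (\<le>) \<psi> (\<lambda>x. trm_value (\<lambda>i. m $ i) (g x))" by (simp add: \<phi>_def subst_fm \<psi>(1))
  then show False using \<psi>(2) by (simp add: true_in_def)
qed

text \<open>The universal statement that no such integer point exists fails in the ring at
  \<open>f\<close>, hence it fails in the integers.\<close>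

lemma integer_points_if_diophantine_correct:
  fixes f :: "'n::finite \<Rightarrow> gen_puiseux" and r :: "real^'l::finite"
  assumes pos: "\<And>i. f i \<in> puiseux_polynomials"
    and nonconst: "\<And>i. \<not> puiseux_const (f i)"
    and \<theta>: "defines_curve \<theta> r f"
    and dc: "diophantine_correct (subring hull (range f)) puiseux_le"
    and U: "open U" "r \<in> U"
  shows "\<exists>s\<in>U. \<exists>m :: int^'n. (\<forall>i. M < \<bar>m $ i\<bar>) \<and> real_models \<theta> s (\<chi> i. of_int (m $ i))"
proof -
  let ?A = "subring hull (range f)"
  obtain \<epsilon> where "\<epsilon> > 0" "ball r \<epsilon> \<subseteq> U" using U open_contains_ball by blast
  \<comment> \<open>Only rational end points are expressible in the language.\<close>
  then obtain a b where ab: "\<forall>i\<in>Basis. a \<bullet> i \<in> \<rat> \<and> b \<bullet> i \<in> \<rat>" "r \<in> box a b" "box a b \<subseteq> U"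
    using rational_boxes[of \<epsilon> r] by blast
  have "axis j (1::real) \<in> Basis" for j :: 'l by simp
  then have rat: "a $ j \<in> \<rat>" "b $ j \<in> \<rat>" for j
    using ab(1) unfolding cart_eq_inner_axis by blast+
  let ?S = "\<lambda>u :: 'l + 'n \<Rightarrow> real. sat UNIV (\<le>) \<theta> u \<and> (\<forall>j\<in>UNIV. a $ j < u (Inl j) \<and> u (Inl j) < b $ j) \<and>
      (\<forall>i\<in>UNIV. of_int M < u (Inr i) \<or> u (Inr i) < - of_int M)"
  have big: "(of_int M < x \<or> x < - of_int M) \<longleftrightarrow> of_int M < \<bar>x\<bar>" for x :: real by auto
  have S: "?S (case_sum (\<lambda>j. s $ j) y) \<longleftrightarrow> real_models \<theta> s (\<chi> i. y i) \<and> s \<in> box a b \<and> (\<forall>i. of_int M < \<bar>y i\<bar>)" for s y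
  proof -
    have "($) (vec_lambda y) = y" by (rule ext) simp
    then show ?thesis unfolding real_models_def mem_box_cart big by auto
  qed
  have "semialgebraic ?S"
    using \<theta> unfolding defines_curve_def
    by (intro semialgebraic_conj semialgebraic_finite_ball semialgebraic_disj semialgebraic_less
        semialgebraic_sat semialgebraic_less_rat rat polynomial_fun_intros) auto
  then have "semialgebraic (\<lambda>v. \<exists>u. (\<forall>x. x \<notin> range Inl \<longrightarrow> u x = v x) \<and> ?S u)"
    by (intro semialgebraic_exists_finite) auto
  moreover have "polynomial_fun (\<lambda>w. case_sum (\<lambda>_. 0) w x)" for x :: "'l + 'n"
    by (cases x) (simp_all add: polynomial_fun_intros)
  ultimately have "semialgebraic (\<lambda>w. \<exists>u. (\<forall>x. x \<notin> range Inl \<longrightarrow> u x = case_sum (\<lambda>_. 0) w x) \<and> ?S u)"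
    by (rule semialgebraic_subst)
  then obtain \<psi> where \<psi>: "quantifier_free \<psi>" "\<And>w. sat UNIV (\<le>) \<psi> w \<longleftrightarrow>
      (\<exists>u. (\<forall>x. x \<notin> range Inl \<longrightarrow> u x = case_sum (\<lambda>_. 0) w x) \<and> ?S u)"
    unfolding semialgebraic_def by auto
  have \<psi>_iff: "sat UNIV (\<le>) \<psi> y \<longleftrightarrow>
      (\<exists>s\<in>box a b. (\<forall>i. of_int M < \<bar>y i\<bar>) \<and> real_models \<theta> s (\<chi> i. y i))" for y
  proof
    assume "sat UNIV (\<le>) \<psi> y"
    then obtain u where u: "\<And>x. x \<notin> range Inl \<Longrightarrow> u x = case_sum (\<lambda>_. 0) y x" "?S u"
      unfolding \<psi>(2) by blast
    have "u = case_sum (\<lambda>j. (\<chi> j. u (Inl j)) $ j) y"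
    proof
      show "u x = case_sum (\<lambda>j. (\<chi> j. u (Inl j)) $ j) y x" for x
        using u(1)[of x] by (cases x) auto
    qed
    then have "?S (case_sum (\<lambda>j. (\<chi> j. u (Inl j)) $ j) y)" using u(2) by metis
    then show "\<exists>s\<in>box a b. (\<forall>i. of_int M < \<bar>y i\<bar>) \<and> real_models \<theta> s (\<chi> i. y i)" unfolding S by blast
  next
    assume "\<exists>s\<in>box a b. (\<forall>i. of_int M < \<bar>y i\<bar>) \<and> real_models \<theta> s (\<chi> i. y i)"
    then obtain s where "?S (case_sum (\<lambda>j. s $ j) y)" unfolding S by blast
    moreover have "\<forall>x. x \<notin> range Inl \<longrightarrow> case_sum (\<lambda>j. s $ j) y x = case_sum (\<lambda>_. 0) y x"
      by (auto split: sum.split)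
    ultimately show "sat UNIV (\<le>) \<psi> y" unfolding \<psi>(2) by blast
  qed
  have "\<forall>\<^sub>F t in at_top. \<forall>i\<in>UNIV. of_int M < \<bar>puiseux_value (f i) t\<bar>"
    using puiseux_value_unbounded[OF pos nonconst] by (intro eventually_ball_finite) (auto simp: filterlim_at_top_dense)
  then have "\<forall>\<^sub>F t in at_top. sat UNIV (\<le>) \<psi> (\<lambda>i. puiseux_value (f i) t)"
    using eventually_ge_at_top[of 1]
  proof eventually_elim
    case (elim t)
    \<comment> \<open>On the curve, \<open>r\<close> itself is the required parameter point in the
      box.\<close>
    have "real_models \<theta> r (\<chi> i. puiseux_value (f i) t)"
      using \<theta> elim(2) unfolding defines_curve_def by auto
    then show ?case using ab(2) elim(1) unfolding \<psi>_iff by blast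
  qed
  with eventually_sat_puiseux[OF \<psi>(1), of ?A f]
  have "\<forall>\<^sub>F t::real in at_top. sat ?A puiseux_le \<psi> f" by eventually_elim simp
  then have sat_f: "sat ?A puiseux_le \<psi> f" by simp
  \<comment> \<open>Sentences have variables in \<open>nat\<close>, so the coordinates are renamed
    injectively; \<open>inv n\<close> gives the remaining variables some arbitrary
    \<open>f i\<close>.\<close>
  obtain n :: "'n \<Rightarrow> nat" where n: "inj n" using finite_imp_inj_to_nat_seg[of "UNIV :: 'n set"] by auto
  define \<psi>' where "\<psi>' = Neg (subst_fm (\<lambda>i. Var (n i)) \<psi>)"
  have qf: "quantifier_free \<psi>'" by (simp add: \<psi>'_def subst_fm \<psi>(1))
  define v where "v k = f (inv n k)" for k
  have "range v \<subseteq> ?A" by (auto simp: v_def intro: hull_inc)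
  moreover have "(\<lambda>i. v (n i)) = f" using n by (simp add: v_def)
  then have "\<not> sat ?A puiseux_le \<psi>' v" using sat_f by (simp add: \<psi>'_def subst_fm \<psi>(1))
  ultimately have "\<not> true_in ?A puiseux_le \<psi>'" unfolding true_in_def by blast
  then have "\<not> true_in UNIV ((\<le>) :: int \<Rightarrow> int \<Rightarrow> bool) \<psi>'" using dc qf unfolding diophantine_correct_iff by blast
  then obtain w :: "nat \<Rightarrow> int" where "\<not> sat UNIV (\<le>) \<psi>' w" by (auto simp: true_in_def)
  then have "sat UNIV (\<le>) \<psi> (\<lambda>i. w (n i))" by (simp add: \<psi>'_def subst_fm \<psi>(1))
  then have "sat UNIV (\<le>) \<psi> (\<lambda>i. real_of_int (w (n i)))" by (subst sat_of_int[OF \<psi>(1)])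
  then obtain s where s: "s \<in> box a b" "\<And>i. real_of_int M < \<bar>real_of_int (w (n i))\<bar>"
    "real_models \<theta> s (\<chi> i. of_int (w (n i)))" unfolding \<psi>_iff by blast
  have "M < \<bar>w (n i)\<bar>" for i using s(2)[of i] by linarith
  then show ?thesis using s ab(3)
    by (intro bexI[of _ s] exI[of _ "\<chi> i. w (n i)"]) auto
qed

theorem theorem2p1:
  fixes f :: "'n::finite \<Rightarrow> gen_puiseux"
    and r :: "real^'l::finite"
  assumes "\<And>i. f i \<in> puiseux_polynomials"
    and "\<And>i. \<not> puiseux_const (f i)"
    and "transcendence_basis r (subfield hull (\<Union>i. puiseux_coeffs (f i)))"
  shows "(\<exists>\<theta>. defines_curve \<theta> r f) \<and>
    (\<forall>\<theta>. defines_curve \<theta> r f \<longrightarrow>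
      (diophantine_correct (subring hull (range f)) puiseux_le \<longleftrightarrow>
        (\<forall>U :: (real^'l) set. \<forall>M :: int. open U \<and> r \<in> U \<and> 0 < M \<longrightarrow>
          (\<exists>s\<in>U. \<exists>m :: int^'n. Min (range (\<lambda>i. \<bar>m $ i\<bar>)) > M \<and>
            real_models \<theta> s (\<chi> i. of_int (m $ i))))))"
proof (intro conjI allI impI)
  show "\<exists>\<theta>. defines_curve \<theta> r f" using curve_definable assms(1,3) by blast
next
  fix \<theta> :: "('l + 'n) fm"
  assume \<theta>: "defines_curve \<theta> r f"
  have indep: "algebraically_independent (\<lambda>j. r $ j)"
    using assms(3) by (simp add: transcendence_basis_def)
  have Min: "Min (range (\<lambda>i. \<bar>m $ i\<bar>)) > M \<longleftrightarrow> (\<forall>i. M < \<bar>m $ i\<bar>)" for m :: "int^'n" and M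
    by (subst Min_gr_iff) auto
  show "diophantine_correct (subring hull (range f)) puiseux_le \<longleftrightarrow>
        (\<forall>U :: (real^'l) set. \<forall>M :: int. open U \<and> r \<in> U \<and> 0 < M \<longrightarrow>
          (\<exists>s\<in>U. \<exists>m :: int^'n. Min (range (\<lambda>i. \<bar>m $ i\<bar>)) > M \<and>
            real_models \<theta> s (\<chi> i. of_int (m $ i))))"
    unfolding Min
    using integer_points_if_diophantine_correct[OF assms(1,2) \<theta>]
      diophantine_correct_if_integer_points[OF assms(1) indep \<theta>] by blast
qed

end
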